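(* Let $0<\kappa<1$. For $\phi$ near $0$ define $$u(\phi)=\int_0^{\phi} F\!\left(\tfrac14,\tfrac34;\tfrac12;\kappa^2\sin^2\theta\right)\,\mathrm{d}\theta ,$$ let $u\mapsto\phi(u)$ be the local inverse near $0$ with $\phi(0)=0$, let $\psi=\psi(u)$ be defined near $u=0$ with $\psi(0)=0$ and $\sin\psi=\kappa\sin\phi$, and set $d=\cos\psi$. Then $d$ extends to an elliptic function, given by $$d=1-\frac{\tfrac12\kappa^2}{\wp+\tfrac13},$$ where $\wp=\wp(\,\cdot\,;g_2,g_3)$ is the Weierstrass elliptic function with invariants $g_2=\tfrac43-\kappa^2$ and $g_3=\tfrac{8}{27}-\tfrac13\kappa^2$.
   Context: $F(a,b;c;z)$ denotes the Gauss hypergeometric function ${}_2F_1(a,b;c;z)$. $\wp(\cdot;g_2,g_3)$ is the Weierstrass function satisfying $(\wp')^2=4\wp^3-g_2\wp-g_3$ with a double pole at $0$. *)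

theory Defs
  imports "HOL-Analysis.Analysis"
begin

text \<open>Gauss hypergeometric function as its power series (used only for |z| < 1).\<close>
definition hyp2f1 :: "real \<Rightarrow> real \<Rightarrow> real \<Rightarrow> real \<Rightarrow> real" where
  "hyp2f1 a b c z =
     (\<Sum>n. (pochhammer a n * pochhammer b n / (pochhammer c n * fact n)) * z ^ n)"

definition u_of :: "real \<Rightarrow> real \<Rightarrow> real" where
  "u_of \<kappa> \<phi> =
     (let f = (\<lambda>\<theta>. hyp2f1 (1/4) (3/4) (1/2) (\<kappa>\<^sup>2 * (sin \<theta>)\<^sup>2))
      in if 0 \<le> \<phi> then integral {0..\<phi>} f else - integral {\<phi>..0} f)"

definition lattice_pt :: "complex \<Rightarrow> complex \<Rightarrow> int \<times> int \<Rightarrow> complex" where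
  "lattice_pt w1 w2 mn = of_int (fst mn) * w1 + of_int (snd mn) * w2"

definition wp_lattice :: "complex \<Rightarrow> complex \<Rightarrow> complex \<Rightarrow> complex" where
  "wp_lattice w1 w2 z = 1 / z\<^sup>2 +
     infsum (\<lambda>mn. 1 / (z - lattice_pt w1 w2 mn)\<^sup>2 - 1 / (lattice_pt w1 w2 mn)\<^sup>2)
            (UNIV - {(0,0)})"

definition g2_lattice :: "complex \<Rightarrow> complex \<Rightarrow> complex" where
  "g2_lattice w1 w2 = 60 * infsum (\<lambda>mn. 1 / (lattice_pt w1 w2 mn) ^ 4) (UNIV - {(0,0)})"

definition g3_lattice :: "complex \<Rightarrow> complex \<Rightarrow> complex" where
  "g3_lattice w1 w2 = 140 * infsum (\<lambda>mn. 1 / (lattice_pt w1 w2 mn) ^ 6) (UNIV - {(0,0)})"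

definition weierstrass_p :: "complex \<Rightarrow> complex \<Rightarrow> complex \<Rightarrow> complex" where
  "weierstrass_p g2 g3 =
     (let L = (SOME L. Im (snd L / fst L) \<noteq> 0 \<and>
                       g2_lattice (fst L) (snd L) = g2 \<and> g3_lattice (fst L) (snd L) = g3)
      in wp_lattice (fst L) (snd L))"

end

theory Submission
  imports Defs "HOL-Complex_Analysis.Complex_Analysis"
begin

text \<open>
  Since \<open>F(1/4,3/4;1/2;sin\<^sup>2 \<psi>) = cos(\<psi>/2) / cos \<psi>\<close> (even part of the binomial series of
  \<open>(1 + x)\<^bsup>-1/2\<^esup>\<close>), the function \<open>y = 1 - cos \<psi>\<close> solves \<open>y'' = \<kappa>\<^sup>2 - 4y + 3y\<^sup>2\<close> with
  \<open>y(0) = y'(0) = 0\<close>.  For every lattice with the stated invariants the differential equation of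
  \<open>\<wp>\<close> shows that \<open>(\<kappa>\<^sup>2/2) / (\<wp> + 1/3)\<close> extends to a solution of the same initial value problem,
  so both agree near \<open>0\<close>.

  A lattice with these invariants exists: the cubic has the real roots \<open>1/6 \<plusminus> \<surd>(1-\<kappa>\<^sup>2)/2\<close> and
  \<open>-1/3\<close>.  For the rectangular lattices generated by \<open>1\<close> and \<open>it\<close> the ratio
  \<open>(e2 - e3)/(e1 - e3)\<close> of differences of half-period values is real and continuous, equals \<open>1/2\<close> for \<open>t = 1\<close> and tends to
  \<open>0\<close> for \<open>t \<rightarrow> \<infinity>\<close>; every ratio in \<open>(0, 1/2]\<close> is attained, ratios in \<open>(1/2, 1)\<close> are reached by
  exchanging \<open>e1\<close> and \<open>e3\<close>, and a complex homothety adjusts the scale.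
\<close>

section \<open>The differential equation satisfied by \<open>1 - cos \<psi>\<close>\<close>

text \<open>The density gives \<open>y' = 2 \<kappa> sin (psi/2) cos phi\<close>, hence
  \<open>y'^2 = 2 \<kappa>^2 y - 4 y^2 + 2 y^3\<close>. The zero function solves this first-order
  equation with the same initial value, so it cannot single out \<open>y\<close>. The derived
  second-order equation has a polynomial right-hand side, and there the two initial values do
  determine \<open>y\<close>. Substituting \<open>y = (\<kappa>^2/2) / P\<close> in the first-order
  equation gives \<open>P'^2 = 4 P^3 - 4 P^2 + \<kappa>^2 P\<close>. Putting
  \<open>P = wp + 1/3\<close> removes the quadratic term; this is the origin of the invariants and
  of the root \<open>-1/3\<close>. Since \<open>weierstrass_p\<close> selects its lattice by choice,
  its value carries information only once some lattice with these invariants exists, and even then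
  only the invariants of the selected lattice are known. Because the roots are real, the inversion
  problem needs only a one-parameter family of lattices and the intermediate value theorem.\<close>

lemma hyp2f1_quarter_sums:
  fixes x :: real
  assumes x: "\<bar>x\<bar> < 1"
  shows "hyp2f1 (1/4) (3/4) (1/2) (x\<^sup>2) = ((1 + x) powr (-1/2) + (1 - x) powr (-1/2)) / 2"
proof -
  define c where "c = (\<lambda>n. (-1/2::real) gchoose n)"
  have s1: "(\<lambda>n. c n * x ^ n) sums (1 + x) powr (-1/2)"
    unfolding c_def by (rule gen_binomial_real[OF x])
  have s2: "(\<lambda>n. c n * (- x) ^ n) sums (1 - x) powr (-1/2)"
    unfolding c_def using gen_binomial_real[of "- x" "-1/2"] x by simp
  have "(\<lambda>n. (c n * x ^ n + c n * (- x) ^ n) / 2) sums (((1 + x) powr (-1/2) + (1 - x) powr (-1/2)) / 2)"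
    by (intro sums_divide sums_add s1 s2)
  then have "(\<lambda>n. (c (2 * n) * x ^ (2 * n) + c (2 * n) * (- x) ^ (2 * n)) / 2) sums
      (((1 + x) powr (-1/2) + (1 - x) powr (-1/2)) / 2)"
  proof (subst sums_mono_reindex[where g = "\<lambda>n. 2 * n"])
    fix n :: nat assume "n \<notin> range (\<lambda>n. 2 * n)"
    then have "odd n" by (auto elim: evenE)
    then show "(c n * x ^ n + c n * (- x) ^ n) / 2 = 0" by (simp add: power_minus_odd)
  qed (auto simp: strict_mono_def)
  moreover have "(c (2 * n) * x ^ (2 * n) + c (2 * n) * (- x) ^ (2 * n)) / 2
      = pochhammer (1/4) n * pochhammer (3/4) n / (pochhammer (1/2) n * fact n) * (x\<^sup>2) ^ n" for n
  proof -
    \<comment> \<open>Duplication of both the Pochhammer symbol and the factorial produces the same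
      factor \<open>4^n\<close>, which cancels and leaves the hypergeometric coefficient.\<close>
    have "c (2 * n) = pochhammer (1/2) (2 * n) / fact (2 * n)"
      by (simp add: c_def gbinomial_pochhammer)
    also have "pochhammer (1/2::real) (2 * n) = 2 ^ (2 * n) * pochhammer (1/4) n * pochhammer (3/4) n"
      using pochhammer_double[of "1/4::real" n] by simp
    also have "(fact (2 * n) :: real) = 2 ^ (2 * n) * pochhammer (1/2) n * fact n"
      by (simp add: fact_double)
    finally have "c (2 * n) = pochhammer (1/4) n * pochhammer (3/4) n / (pochhammer (1/2) n * fact n)"
      by (simp add: mult.assoc)
    then show ?thesis by (simp add: power_mult) (simp add: mult_ac)
  qed
  ultimately show ?thesis unfolding hyp2f1_def by (simp only: sums_unique[symmetric])
qed

text \<open>Because \<open>cos \<psi>\<close> is the difference of the squares of the two sides.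
  With \<open>s\<close> and \<open>c\<close> for sine and cosine of the half angle, the bound makes
  \<open>c + s\<close> and \<open>c - s\<close> positive, so that each is the square root of its
  square.\<close>

lemma abs_sin_less_cos_half:
  fixes \<psi> :: real
  assumes "\<bar>\<psi>\<bar> < pi / 2"
  shows "\<bar>sin (\<psi> / 2)\<bar> < cos (\<psi> / 2)"
proof -
  have c: "cos (\<psi> / 2) > 0" using assms by (intro cos_gt_zero_pi) auto
  have "cos \<psi> > 0" using assms by (intro cos_gt_zero_pi) auto
  then have "(sin (\<psi> / 2))\<^sup>2 < (cos (\<psi> / 2))\<^sup>2"
    using cos_double[of "\<psi> / 2"] by simp
  then show ?thesis using c by (metis abs_of_pos power2_less_imp_less power2_abs abs_ge_zero less_imp_le)
qed

text \<open>In terms of the half angle, \<open>1 + sin \<psi> = (c + s)^2\<close> and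
  \<open>1 - sin \<psi> = (c - s)^2\<close>; the mean of the reciprocals \<open>1/(c + s)\<close>
  and \<open>1/(c - s)\<close> is \<open>c / (c^2 - s^2)\<close>.\<close>

lemma hyp2f1_quarter_sin:
  fixes \<psi> :: real
  assumes "\<bar>\<psi>\<bar> < pi / 2"
  shows "hyp2f1 (1/4) (3/4) (1/2) ((sin \<psi>)\<^sup>2) = cos (\<psi> / 2) / cos \<psi>"
proof -
  define s c where "s = sin (\<psi> / 2)" and "c = cos (\<psi> / 2)"
  have sc: "\<bar>s\<bar> < c" using abs_sin_less_cos_half[OF assms] by (simp add: s_def c_def)
  have one: "s\<^sup>2 + c\<^sup>2 = 1" by (simp add: s_def c_def)
  have sin: "sin \<psi> = 2 * s * c" using sin_double[of "\<psi> / 2"] by (simp add: s_def c_def)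
  have cos: "cos \<psi> = c\<^sup>2 - s\<^sup>2" using cos_double[of "\<psi> / 2"] by (simp add: s_def c_def)
  have "cos \<psi> > 0" using assms by (intro cos_gt_zero_pi) auto
  then have "(sin \<psi>)\<^sup>2 < 1" using sin_cos_squared_add[of \<psi>] by (smt (verit) zero_less_power)
  then have "\<bar>sin \<psi>\<bar> < 1" by (simp add: abs_square_less_1)
  moreover have "1 + sin \<psi> = (c + s)\<^sup>2" "1 - sin \<psi> = (c - s)\<^sup>2"
    using one sin by (simp_all add: power2_eq_square algebra_simps)
  moreover have "(y\<^sup>2) powr (-1/2) = 1 / y" if "y > 0" for y :: real
    using that by (simp add: powr_minus_divide powr_half_sqrt)
  ultimately have "hyp2f1 (1/4) (3/4) (1/2) ((sin \<psi>)\<^sup>2) = (1 / (c + s) + 1 / (c - s)) / 2"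
    using sc by (simp add: hyp2f1_quarter_sums)
  also have "\<dots> = c / ((c + s) * (c - s))" using sc by (simp add: divide_simps) linarith
  also have "(c + s) * (c - s) = c\<^sup>2 - s\<^sup>2" by (simp add: power2_eq_square algebra_simps)
  finally show ?thesis by (simp add: cos c_def)
qed

definition u_density :: "real \<Rightarrow> real \<Rightarrow> real" where
  "u_density \<kappa> \<theta> = hyp2f1 (1/4) (3/4) (1/2) (\<kappa>\<^sup>2 * (sin \<theta>)\<^sup>2)"

context
  fixes \<kappa> :: real
  assumes \<kappa>: "0 < \<kappa>" "\<kappa> < 1"
begin

lemma abs_kappa_sin: "\<bar>\<kappa> * sin \<theta>\<bar> < 1"
proof -
  have "\<kappa> * \<bar>sin \<theta>\<bar> \<le> \<kappa> * 1" using \<kappa> by (intro mult_left_mono) auto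
  also have "\<dots> < 1" using \<kappa> by simp
  finally show ?thesis using \<kappa> by (simp add: abs_mult)
qed

lemma u_density_eq:
  assumes "\<bar>\<psi>\<bar> < pi / 2" "sin \<psi> = \<kappa> * sin \<theta>"
  shows "u_density \<kappa> \<theta> = cos (\<psi> / 2) / cos \<psi>"
  unfolding u_density_def using hyp2f1_quarter_sin[OF assms(1)] by (simp add: assms(2) power_mult_distrib)

text \<open>With \<open>c = cos (\<psi>/2)\<close> in \<open>[0, 1]\<close> one has
  \<open>cos \<psi> - c = (2 c + 1) (c - 1) \<le> 0\<close>.\<close>

lemma u_density_ge_1: "1 \<le> u_density \<kappa> \<theta>"
proof -
  define \<psi> where "\<psi> = arcsin (\<kappa> * sin \<theta>)"
  have b: "- 1 < \<kappa> * sin \<theta>" "\<kappa> * sin \<theta> < 1" using abs_kappa_sin[of \<theta>] by auto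
  have \<psi>: "\<bar>\<psi>\<bar> < pi / 2" "sin \<psi> = \<kappa> * sin \<theta>"
    using arcsin_lt_bounded[OF b] b by (auto simp: \<psi>_def)
  have "cos \<psi> > 0" using \<psi>(1) by (intro cos_gt_zero_pi) auto
  moreover have "cos \<psi> \<le> cos (\<psi> / 2)"
  proof -
    have "0 \<le> cos (\<psi> / 2)" using abs_sin_less_cos_half[OF \<psi>(1)] by linarith
    then have "(2 * cos (\<psi> / 2) + 1) * (cos (\<psi> / 2) - 1) \<le> 0"
      by (intro mult_nonneg_nonpos) auto
    then show ?thesis using cos_double_cos[of "\<psi> / 2"] by (simp add: algebra_simps power2_eq_square)
  qed
  ultimately show ?thesis by (simp add: u_density_eq[OF \<psi>])
qed

lemma continuous_u_density: "continuous_on A (u_density \<kappa>)"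
proof -
  have "u_density \<kappa> = (\<lambda>\<theta>. ((1 + \<kappa> * sin \<theta>) powr (-1/2) + (1 - \<kappa> * sin \<theta>) powr (-1/2)) / 2)"
    using hyp2f1_quarter_sums[OF abs_kappa_sin]
    by (simp add: u_density_def fun_eq_iff power_mult_distrib)
  moreover have "1 + \<kappa> * sin \<theta> \<noteq> 0" "1 - \<kappa> * sin \<theta> \<noteq> 0" for \<theta>
    using abs_kappa_sin[of \<theta>] by auto
  ultimately show ?thesis by (auto intro!: continuous_intros)
qed

text \<open>A single antiderivative \<open>g\<close> on an interval around both \<open>0\<close> and
  \<open>x\<close> turns the two branches of \<open>u_of\<close> into the one formula
  \<open>g y - g 0\<close>, so no case distinction survives at the origin.\<close>

lemma u_of_has_derivative: "(u_of \<kappa> has_real_derivative u_density \<kappa> x) (at x)"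
proof -
  define R where "R = \<bar>x\<bar> + 1"
  obtain g where g: "\<And>y. y \<in> {- R..R} \<Longrightarrow> (g has_vector_derivative u_density \<kappa> y) (at y within {- R..R})"
    using antiderivative_continuous[OF continuous_u_density, of "- R" R] by metis
  have int: "(u_density \<kappa> has_integral g b - g a) {a..b}" if "- R \<le> a" "a \<le> b" "b \<le> R" for a b
  proof (rule fundamental_theorem_of_calculus)
    fix x assume "x \<in> {a..b}"
    with that have "x \<in> {- R..R}" "{a..b} \<subseteq> {- R..R}" by auto
    then show "(g has_vector_derivative u_density \<kappa> x) (at x within {a..b})"
      using g has_vector_derivative_within_subset by blast
  qed (use that in auto)
  have u_of_eq: "u_of \<kappa> y = (if 0 \<le> y then integral {0..y} (u_density \<kappa>) else - integral {y..0} (u_density \<kappa>))" for y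
    by (simp add: u_of_def u_density_def[abs_def])
  have eq: "u_of \<kappa> y = g y - g 0" if "y \<in> {- R<..<R}" for y
  proof (cases "0 \<le> y")
    case True
    then show ?thesis using integral_unique[OF int[of 0 y]] that by (simp add: u_of_eq)
  next
    case False
    then show ?thesis using integral_unique[OF int[of y 0]] that by (simp add: u_of_eq)
  qed
  have x: "x \<in> {- R<..<R}" by (auto simp: R_def)
  then have "(g has_real_derivative u_density \<kappa> x) (at x)"
    using g[of x] at_within_Icc_at[of "- R" x R]
    by (auto simp: has_real_derivative_iff_has_vector_derivative)
  then have "((\<lambda>y. g y - g 0) has_real_derivative u_density \<kappa> x) (at x)"
    by (auto intro!: derivative_eq_intros)
  then show ?thesis
    by (rule has_field_derivative_transform_within_open[OF _ _ x]) (use eq in auto)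
qed

text \<open>By the mean value theorem, as the derivative is at least \<open>1\<close>. It makes any
  local inverse 1-Lipschitz, which supplies the continuity of \<open>phi\<close> required for
  differentiating the inverse.\<close>

lemma u_of_expanding: "\<bar>b - a\<bar> \<le> \<bar>u_of \<kappa> b - u_of \<kappa> a\<bar>"
proof -
  have "b - a \<le> u_of \<kappa> b - u_of \<kappa> a" if ab: "a < b" for a b
  proof -
    obtain \<xi> where "u_of \<kappa> b - u_of \<kappa> a = (b - a) * u_density \<kappa> \<xi>"
      using MVT2[OF ab, of "u_of \<kappa>" "u_density \<kappa>"] u_of_has_derivative by blast
    moreover have "(b - a) * 1 \<le> (b - a) * u_density \<kappa> \<xi>"
      using ab u_density_ge_1 by (intro mult_left_mono) auto
    ultimately show ?thesis by simp
  qed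
  from this[of a b] this[of b a] show ?thesis by (cases a b rule: linorder_cases) auto
qed

lemma local_inverse_derivative:
  assumes inv: "\<And>u. \<bar>u\<bar> < \<delta> \<Longrightarrow> u_of \<kappa> (phi u) = u" and u: "\<bar>u\<bar> < \<delta>"
  shows "(phi has_real_derivative inverse (u_density \<kappa> (phi u))) (at u)"
proof (rule DERIV_inverse_function[where f = "u_of \<kappa>"])
  show "isCont phi u"
    unfolding isCont_def LIM_def
  proof (intro allI impI)
    fix r :: real assume "0 < r"
    have "dist (phi x) (phi u) < r" if "dist x u < min r (\<delta> - \<bar>u\<bar>)" for x
    proof -
      have "\<bar>x\<bar> < \<delta>" using that by (auto simp: dist_real_def)
      then show ?thesis using u_of_expanding[of "phi x" "phi u"] inv u that
        by (auto simp: dist_real_def)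
    qed
    then show "\<exists>s>0. \<forall>x. x \<noteq> u \<and> dist x u < s \<longrightarrow> dist (phi x) (phi u) < r"
      using \<open>0 < r\<close> u by (intro exI[of _ "min r (\<delta> - \<bar>u\<bar>)"]) auto
  qed
  show "u_density \<kappa> (phi u) \<noteq> 0" using u_density_ge_1[of "phi u"] by linarith
  show "- \<delta> < u" "u < \<delta>" using u by auto
qed (use inv u_of_has_derivative in auto)

text \<open>From \<open>phi' = cos psi / cos (psi/2)\<close> and
  \<open>psi' = \<kappa> cos phi / cos (psi/2)\<close>, the factor \<open>cos (psi/2)\<close> of
  \<open>sin psi\<close> cancels the denominator in \<open>y' = sin psi * psi'\<close>. The
  resulting product is easy to differentiate once more.\<close>

lemma psi_derivatives:
  assumes \<delta>: "0 < \<delta>" and inv: "\<And>u. \<bar>u\<bar> < \<delta> \<Longrightarrow> u_of \<kappa> (phi u) = u"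
    and psi0: "psi 0 = 0" and cont: "continuous_on {-\<delta><..<\<delta>} psi"
    and sin: "\<And>u. \<bar>u\<bar> < \<delta> \<Longrightarrow> sin (psi u) = \<kappa> * sin (phi u)"
  obtains \<epsilon> where "\<epsilon> > 0"
    "\<forall>u. \<bar>u\<bar> < \<epsilon> \<longrightarrow> ((\<lambda>u. 1 - cos (psi u)) has_real_derivative 2 * \<kappa> * sin (psi u / 2) * cos (phi u)) (at u)"
    "\<forall>u. \<bar>u\<bar> < \<epsilon> \<longrightarrow> ((\<lambda>u. 2 * \<kappa> * sin (psi u / 2) * cos (phi u)) has_real_derivative
        \<kappa>\<^sup>2 - 4 * (1 - cos (psi u)) + 3 * (1 - cos (psi u))\<^sup>2) (at u)"
proof -
  \<comment> \<open>Continuity keeps \<open>psi\<close> inside \<open>(-pi/2, pi/2)\<close> near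
    \<open>0\<close>. This fixes the branch: there \<open>psi\<close> is
    \<open>arcsin (\<kappa> sin phi)\<close>, and its differentiability follows from that of
    \<open>phi\<close>.\<close>
  have "isCont psi 0" using cont \<delta> by (simp add: continuous_on_eq_continuous_at)
  then obtain \<epsilon>1 where \<epsilon>1: "\<epsilon>1 > 0" "\<And>u. \<bar>u\<bar> < \<epsilon>1 \<Longrightarrow> \<bar>psi u\<bar> < pi / 2"
    using psi0 pi_half_gt_zero unfolding continuous_at_eps_delta by (metis dist_real_def diff_zero)
  define \<epsilon> where "\<epsilon> = min \<epsilon>1 \<delta>"
  have \<epsilon>: "\<epsilon> > 0" "\<epsilon> \<le> \<delta>" using \<epsilon>1 \<delta> by (auto simp: \<epsilon>_def)
  have dphi: "(phi has_real_derivative cos (psi u) / cos (psi u / 2)) (at u)"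
    and dpsi: "(psi has_real_derivative \<kappa> * cos (phi u) / cos (psi u / 2)) (at u)"
    and pos: "cos (psi u / 2) > 0" if u: "\<bar>u\<bar> < \<epsilon>" for u
  proof -
    have b: "\<bar>psi v\<bar> < pi / 2" "sin (psi v) = \<kappa> * sin (phi v)" if "\<bar>v\<bar> < \<epsilon>" for v
      using that \<epsilon>1(2)[of v] sin[of v] by (auto simp: \<epsilon>_def)
    have "cos (psi u) > 0" using b(1)[OF u] by (intro cos_gt_zero_pi) auto
    show "cos (psi u / 2) > 0" using abs_sin_less_cos_half[OF b(1)[OF u]] by linarith
    show dphi: "(phi has_real_derivative cos (psi u) / cos (psi u / 2)) (at u)"
      using local_inverse_derivative[OF inv, of \<delta> u] u \<epsilon>(2) u_density_eq[OF b[OF u]] by simp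
    have c: "sqrt (1 - (\<kappa> * sin (phi u))\<^sup>2) = cos (psi u)"
      using b(2)[OF u, symmetric] \<open>cos (psi u) > 0\<close> by (simp flip: cos_squared_eq)
    have "- 1 < \<kappa> * sin (phi u)" "\<kappa> * sin (phi u) < 1" using abs_kappa_sin[of "phi u"] by auto
    from DERIV_arcsin[OF this]
    have "((\<lambda>v. arcsin (\<kappa> * sin (phi v))) has_real_derivative
        inverse (cos (psi u)) * (\<kappa> * (cos (phi u) * (cos (psi u) / cos (psi u / 2))))) (at u)"
      unfolding c by (rule DERIV_chain2) (auto intro!: derivative_eq_intros dphi)
    moreover have "inverse (cos (psi u)) * (\<kappa> * (cos (phi u) * (cos (psi u) / cos (psi u / 2)))) = \<kappa> * cos (phi u) / cos (psi u / 2)"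
      using \<open>cos (psi u) > 0\<close> by (simp add: field_simps)
    ultimately have "((\<lambda>v. arcsin (\<kappa> * sin (phi v))) has_real_derivative \<kappa> * cos (phi u) / cos (psi u / 2)) (at u)"
      by (simp only:)
    then show "(psi has_real_derivative \<kappa> * cos (phi u) / cos (psi u / 2)) (at u)"
    proof (rule has_field_derivative_transform_within_open)
      show "u \<in> {- \<epsilon><..<\<epsilon>}" using u by auto
      fix v assume "v \<in> {- \<epsilon><..<\<epsilon>}"
      then have "\<bar>v\<bar> < \<epsilon>" by auto
      note b[OF this]
      then show "arcsin (\<kappa> * sin (phi v)) = psi v" by (metis abs_less_iff arcsin_sin less_imp_le minus_less_iff)
    qed auto
  qed
  show ?thesis
  proof (rule that[OF \<epsilon>(1)]; intro allI impI)
    fix u assume u: "\<bar>u\<bar> < \<epsilon>"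
    define s c where "s = sin (psi u / 2)" and "c = cos (psi u / 2)"
    have c: "c > 0" using pos[OF u] by (simp add: c_def)
    have sc: "sin (psi u) = 2 * s * c" "cos (psi u) = 1 - 2 * s\<^sup>2" "c\<^sup>2 = 1 - s\<^sup>2"
      using sin_double[of "psi u / 2"] cos_double_sin[of "psi u / 2"] by (simp_all add: s_def c_def cos_squared_eq)
    have "((\<lambda>u. 1 - cos (psi u)) has_real_derivative sin (psi u) * (\<kappa> * cos (phi u) / cos (psi u / 2))) (at u)"
      by (auto intro!: derivative_eq_intros dpsi[OF u])
    then show "((\<lambda>u. 1 - cos (psi u)) has_real_derivative 2 * \<kappa> * sin (psi u / 2) * cos (phi u)) (at u)"
      using c by (simp add: sc(1) flip: s_def c_def) (simp add: mult_ac)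
    have "((\<lambda>u. 2 * \<kappa> * sin (psi u / 2) * cos (phi u)) has_real_derivative
        2 * \<kappa> * (c * (\<kappa> * cos (phi u) / c) / 2 * cos (phi u) - s * (sin (phi u) * (cos (psi u) / c)))) (at u)"
      unfolding s_def c_def using c
      by (auto intro!: derivative_eq_intros dpsi[OF u] dphi[OF u] simp: algebra_simps)
    moreover have "2 * \<kappa> * (c * (\<kappa> * cos (phi u) / c) / 2 * cos (phi u) - s * (sin (phi u) * (cos (psi u) / c)))
      = \<kappa>\<^sup>2 - 4 * (1 - cos (psi u)) + 3 * (1 - cos (psi u))\<^sup>2"
    proof -
      have ks: "\<kappa> * sin (phi u) = 2 * s * c" using sin[of u] u \<epsilon>(2) sc(1) by simp
      have "2 * \<kappa> * (c * (\<kappa> * cos (phi u) / c) / 2 * cos (phi u) - s * (sin (phi u) * (cos (psi u) / c)))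
         = \<kappa>\<^sup>2 * (cos (phi u))\<^sup>2 - 2 * s * (\<kappa> * sin (phi u)) * (cos (psi u) / c)"
        using c by (simp add: power2_eq_square algebra_simps)
      also have "\<kappa>\<^sup>2 * (cos (phi u))\<^sup>2 = \<kappa>\<^sup>2 - (\<kappa> * sin (phi u))\<^sup>2"
        by (simp add: cos_squared_eq power_mult_distrib algebra_simps)
      also have "2 * s * (\<kappa> * sin (phi u)) * (cos (psi u) / c) = 4 * s\<^sup>2 * cos (psi u)"
        unfolding ks using c by (simp add: power2_eq_square)
      \<comment> \<open>Both sides equal \<open>\<kappa>^2 - 8 s^2 + 12 s^4\<close>, since
        \<open>1 - cos (psi u) = 2 s^2\<close>.\<close>
      also have "\<kappa>\<^sup>2 - (\<kappa> * sin (phi u))\<^sup>2 - 4 * s\<^sup>2 * cos (psi u) = \<kappa>\<^sup>2 - 4 * (1 - cos (psi u)) + 3 * (1 - cos (psi u))\<^sup>2"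
        unfolding ks sc(2) power_mult_distrib sc(3) by (simp add: power2_eq_square algebra_simps)
      finally show ?thesis .
    qed
    ultimately show "((\<lambda>u. 2 * \<kappa> * sin (psi u / 2) * cos (phi u)) has_real_derivative
        \<kappa>\<^sup>2 - 4 * (1 - cos (psi u)) + 3 * (1 - cos (psi u))\<^sup>2) (at u)" by simp
  qed
qed

end

section \<open>Uniqueness for second-order initial value problems\<close>

text \<open>Let \<open>M\<close> be the maximum of the norm of \<open>g\<close> on
  \<open>[-a, a]\<close>. Integrating twice from \<open>0\<close> gives the bounds
  \<open>M a\<close> for \<open>f\<close>, \<open>C M a\<close> for \<open>h\<close> and
  \<open>C a^2 M\<close> for \<open>g\<close>. The choice of \<open>a\<close> makes
  \<open>C a\<close> and \<open>a\<close> at most \<open>1/2\<close>, so \<open>C a^2 < 1\<close>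
  and \<open>M = 0\<close>.\<close>

lemma second_order_gronwall:
  fixes f g h :: "real \<Rightarrow> complex"
  assumes \<delta>: "\<delta> > 0" and f: "\<And>u. \<bar>u\<bar> < \<delta> \<Longrightarrow> (f has_vector_derivative g u) (at u)"
    and g: "\<And>u. \<bar>u\<bar> < \<delta> \<Longrightarrow> (g has_vector_derivative h u) (at u)"
    and h: "\<And>u. \<bar>u\<bar> < \<delta> \<Longrightarrow> norm (h u) \<le> C * norm (f u)" and C: "C \<ge> 0"
    and f0: "f 0 = 0" and g0: "g 0 = 0"
  obtains \<epsilon> where "\<epsilon> > 0" "\<And>u. \<bar>u\<bar> < \<epsilon> \<Longrightarrow> f u = 0"
proof -
  define a where "a = min (\<delta> / 2) (1 / (2 * (C + 1)))"
  have a: "a > 0" "a < \<delta>" "C * a * a < 1"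
  proof -
    show "a > 0" "a < \<delta>" using \<delta> C by (auto simp: a_def min_less_iff_disj)
    have a1: "a \<le> 1 / (2 * (C + 1))" by (simp add: a_def)
    then have "a * (2 * (C + 1)) \<le> 1" using C by (simp add: pos_le_divide_eq)
    then have "C * a \<le> 1 / 2" "a \<le> 1/2" using \<open>a > 0\<close> C by (auto simp: algebra_simps) (smt (verit) mult_nonneg_nonneg)+
    then have "(C * a) * a \<le> (1/2) * (1/2)" using \<open>a > 0\<close> C by (intro mult_mono) auto
    then show "C * a * a < 1" by simp
  qed
  have bound: "norm (F u) \<le> B * a"
    if F: "\<And>u. \<bar>u\<bar> < \<delta> \<Longrightarrow> (F has_vector_derivative F' u) (at u)" and F0: "F 0 = 0"
      and B: "\<And>u. u \<in> {- a..a} \<Longrightarrow> norm (F' u) \<le> B" and u: "u \<in> {- a..a}" for F F' :: "real \<Rightarrow> complex" and B u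
  proof -
    have "norm (F u - F 0) \<le> B * norm (u - 0)"
    proof (rule differentiable_bound[where S = "{- a..a}" and f' = "\<lambda>x t. t *\<^sub>R F' x"])
      show "(F has_derivative (\<lambda>t. t *\<^sub>R F' x)) (at x within {- a..a})" if "x \<in> {- a..a}" for x
        using F[of x] that a by (auto simp: has_vector_derivative_def intro: has_derivative_at_withinI)
      show "onorm (\<lambda>t. t *\<^sub>R F' x) \<le> B" if "x \<in> {- a..a}" for x
        using B[OF that] by (intro onorm_le) (simp add: mult.commute[of B] mult_left_mono)
    qed (use u a in auto)
    also have "\<dots> \<le> B * a"
    proof (rule mult_left_mono)
      show "0 \<le> B" using B[OF u] norm_ge_zero order_trans by blast
    qed (use u in auto)
    finally show ?thesis using F0 by simp
  qed
  have "isCont g u" if "u \<in> {- a..a}" for u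
    using has_vector_derivative_continuous[OF g[of u]] that a by auto
  then have "continuous_on {- a..a} g" by (simp add: continuous_at_imp_continuous_on)
  then have "continuous_on {- a..a} (\<lambda>u. norm (g u))" by (intro continuous_intros)
  then obtain m where m: "m \<in> {- a..a}" "\<And>u. u \<in> {- a..a} \<Longrightarrow> norm (g u) \<le> norm (g m)"
    using continuous_attains_sup[of "{- a..a}" "\<lambda>u. norm (g u)"] a by auto
  have f_le: "norm (f u) \<le> norm (g m) * a" if "u \<in> {- a..a}" for u
    by (rule bound[OF f f0 m(2) that])
  have "norm (h u) \<le> C * (norm (g m) * a)" if "u \<in> {- a..a}" for u
  proof -
    have "\<bar>u\<bar> < \<delta>" using that a by auto
    from h[OF this] mult_left_mono[OF f_le[OF that] C] show ?thesis by linarith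
  qed
  from bound[OF g g0 this m(1)] have "norm (g m) \<le> (C * a * a) * norm (g m)" by (simp add: mult_ac)
  then have "norm (g m) * (1 - C * a * a) \<le> 0" by (simp add: algebra_simps)
  then have "norm (g m) \<le> 0" using a(3) by (simp add: mult_le_0_iff)
  then have "f u = 0" if "\<bar>u\<bar> < a" for u
  proof -
    have "u \<in> {- a..a}" using that by auto
    from f_le[OF this] \<open>norm (g m) \<le> 0\<close> show ?thesis by simp
  qed
  with a(1) show ?thesis by (rule that)
qed

section \<open>Lattices and the Weierstrass function\<close>

text \<open>The weight \<open>ht\<close> is bounded by a multiple of \<open>max \<bar>m\<bar> \<bar>n\<bar>\<close>, hence of the norm of the lattice
  points, but its product form turns \<open>\<Sum> 1 / ht^3\<close> into a product of two single series.\<close>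
definition ht :: "int \<times> int \<Rightarrow> real" where
  "ht mn = sqrt ((1 + \<bar>of_int (fst mn)\<bar>) * (1 + \<bar>of_int (snd mn)\<bar>))"

lemma ht_ge_1: "1 \<le> ht mn"
proof -
  have "1 * 1 \<le> (1 + \<bar>real_of_int (fst mn)\<bar>) * (1 + \<bar>of_int (snd mn)\<bar>)"
    by (intro mult_mono) auto
  then show ?thesis by (simp add: ht_def)
qed

lemma ht_le_max: 
  assumes "mn \<noteq> (0,0)"
  shows "ht mn \<le> 2 * max \<bar>of_int (fst mn)\<bar> \<bar>of_int (snd mn)\<bar>"
proof -
  define N where "N = max \<bar>real_of_int (fst mn)\<bar> \<bar>of_int (snd mn)\<bar>"
  have "1 \<le> N"
  proof (cases "fst mn = 0")
    case True
    then have "snd mn \<noteq> 0" using assms by (metis prod.collapse)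
    then have "1 \<le> \<bar>real_of_int (snd mn)\<bar>" by linarith
    then show ?thesis by (simp add: N_def)
  next
    case False
    then have "1 \<le> \<bar>real_of_int (fst mn)\<bar>" by linarith
    then show ?thesis by (simp add: N_def)
  qed
  then have "(1 + \<bar>real_of_int (fst mn)\<bar>) * (1 + \<bar>of_int (snd mn)\<bar>) \<le> (2*N) * (2*N)"
    by (intro mult_mono) (auto simp: N_def)
  then have "ht mn \<le> sqrt ((2*N)^2)" unfolding ht_def by (simp only: real_sqrt_le_iff power2_eq_square)
  also have "\<dots> = 2 * N" using \<open>1 \<le> N\<close> by (subst real_sqrt_abs) simp
  finally show ?thesis by (simp add: N_def)
qed

lemma summable_on_inverse_sqrt_cube_int:
  "(\<lambda>k::int. 1 / sqrt (1 + \<bar>of_int k\<bar>) ^ 3) summable_on UNIV"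
proof -
  have eq: "1 / sqrt (1 + real n) ^ 3 = real (Suc n) powr (-3/2)" for n
  proof -
    have "sqrt (1 + real n) ^ 3 = (real (Suc n) powr (1/2)) ^ 3"
      by (simp add: powr_half_sqrt)
    also have "\<dots> = real (Suc n) powr (3/2)"
      by (subst powr_power) auto
    finally show ?thesis by (simp add: powr_minus_divide)
  qed
  have s: "summable (\<lambda>n. 1 / sqrt (1 + real n) ^ 3)"
    unfolding eq using summable_Suc_iff[of "\<lambda>n. real n powr (-3/2)"]
    by (simp add: summable_real_powr_iff)
  have sn: "(\<lambda>n. 1 / sqrt (1 + real n) ^ 3) summable_on UNIV"
    using s by (subst summable_on_UNIV_nonneg_real_iff) auto
  have "(\<lambda>k::int. 1 / sqrt (1 + \<bar>of_int k\<bar>) ^ 3) summable_on range int"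
    using sn by (subst summable_on_reindex) (auto simp: o_def inj_on_def)
  moreover have "(\<lambda>k::int. 1 / sqrt (1 + \<bar>of_int k\<bar>) ^ 3) summable_on range (\<lambda>n. - int n)"
    using sn by (subst summable_on_reindex) (auto simp: o_def inj_on_def)
  ultimately have "(\<lambda>k::int. 1 / sqrt (1 + \<bar>of_int k\<bar>) ^ 3) summable_on (range int \<union> (range (\<lambda>n. - int n) - range int))"
    by (intro summable_on_Un_disjoint) (auto intro: summable_on_subset_banach)
  moreover have "range int \<union> (range (\<lambda>n. - int n) - range int) = UNIV"
  proof -
    have "k \<in> range int \<union> range (\<lambda>n. - int n)" for k by (cases k rule: int_cases2) auto
    then show ?thesis by blast
  qed
  ultimately show ?thesis by simp
qed

lemma summable_on_inverse_ht_cube: "(\<lambda>mn. 1 / ht mn ^ 3) summable_on A"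
proof -
  let ?g = "\<lambda>k::int. 1 / sqrt (1 + \<bar>of_int k\<bar>) ^ 3"
  have "(\<lambda>mn. ?g (fst mn) * ?g (snd mn)) summable_on (UNIV \<times> UNIV)"
  proof (rule summable_on_SigmaI)
    show "((\<lambda>y. ?g (fst (x, y)) * ?g (snd (x, y))) has_sum (?g x * infsum ?g UNIV)) UNIV" for x
      using has_sum_cmult_right[OF has_sum_infsum[OF summable_on_inverse_sqrt_cube_int], of "?g x"] by simp
    show "(\<lambda>x. ?g x * infsum ?g UNIV) summable_on UNIV"
      by (rule summable_on_cmult_left[OF summable_on_inverse_sqrt_cube_int])
  qed auto
  moreover have "(\<lambda>mn. ?g (fst mn) * ?g (snd mn)) = (\<lambda>mn. 1 / ht mn ^ 3)"
    by (auto simp: ht_def fun_eq_iff real_sqrt_mult power_mult_distrib)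
  ultimately show ?thesis by (auto intro: summable_on_subset_banach)
qed

lemma inverse_cube_le:
  assumes "0 < c" "c * ht mn \<le> \<rho>"
  shows "1 / \<rho> ^ 3 \<le> (1 / c ^ 3) * (1 / ht mn ^ 3)"
proof -
  have h: "0 < ht mn" using ht_ge_1[of mn] by linarith
  then have "(c * ht mn) ^ 3 \<le> \<rho> ^ 3" using assms by (intro power_mono) auto
  moreover have "0 < c * ht mn" using h assms by simp
  ultimately have "1 / \<rho> ^ 3 \<le> 1 / (c * ht mn) ^ 3"
    using assms(2) by (intro divide_left_mono) (auto intro!: mult_pos_pos zero_less_power)
  then show ?thesis by (simp add: power_mult_distrib)
qed

lemma summable_on_dominated_ht:
  fixes f :: "int \<times> int \<Rightarrow> 'a::banach"
  assumes "\<And>mn. mn \<in> A \<Longrightarrow> norm (f mn) \<le> C * (1 / ht mn ^ 3)"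
  shows "f summable_on A"
  by (rule abs_summable_summable, rule Infinite_Sum.abs_summable_on_comparison_test'[OF
        summable_on_cmult_right[OF summable_on_inverse_ht_cube, of C A]]) (use assms in auto)

lemma has_sum_uminus_int_pair:
  "((\<lambda>(m::int,n::int). f (- m, - n)) has_sum s) (UNIV - {(0,0)}) = (f has_sum s) (UNIV - {(0,0)})"
  by (rule has_sum_reindex_bij_witness[of _ "\<lambda>(m,n). (-m,-n)" "\<lambda>(m,n). (-m,-n)"]) auto

lemma has_sum_odd_eq_0:
  fixes f :: "int \<times> int \<Rightarrow> complex"
  assumes f: "(f has_sum s) (UNIV - {(0,0)})" and "\<And>m n. f (- m, - n) = - f (m, n)"
  shows "s = 0"
proof -
  have "((\<lambda>(m,n). f (- m, - n)) has_sum s) (UNIV - {(0,0)})"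
    using f by (subst has_sum_uminus_int_pair)
  then have "((\<lambda>mn. - f mn) has_sum s) (UNIV - {(0,0)})" by (simp add: assms case_prod_unfold)
  moreover have "((\<lambda>mn. - f mn) has_sum - s) (UNIV - {(0,0)})" using f by (simp add: has_sum_uminus)
  ultimately have "s = - s" by (metis has_sum_unique)
  then show ?thesis by simp
qed

section \<open>Geometry of a lattice\<close>

text \<open>The imaginary part is only required to be nonzero, as in \<open>weierstrass_p\<close>.
  The condition is then symmetric in the two generators, and facts about \<open>w1\<close> transfer
  to \<open>w2\<close> by interpreting the locale with the generators exchanged.\<close>

locale complex_lattice =
  fixes w1 w2 :: complex
  assumes Im_ratio: "Im (w2 / w1) \<noteq> 0"
begin

abbreviation \<omega> :: "int \<times> int \<Rightarrow> complex" where "\<omega> \<equiv> lattice_pt w1 w2"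
abbreviation \<Lambda> :: "complex set" where "\<Lambda> \<equiv> range \<omega>"

lemma w_nonzero: "w1 \<noteq> 0" "w2 \<noteq> 0"
  using Im_ratio by auto

text \<open>After division by \<open>w1\<close>, the imaginary part of \<open>x + y \<tau>\<close>
  is \<open>y Im \<tau>\<close> and controls \<open>y\<close>; the triangle inequality then controls
  \<open>x\<close>.\<close>

lemma norm_lincomb_ge:
  obtains c where "c > 0" "\<And>x y. c * max \<bar>x\<bar> \<bar>y\<bar> \<le> norm (of_real x * w1 + of_real y * w2)"
proof -
  define \<tau> where "\<tau> = w2 / w1"
  define c1 where "c1 = \<bar>Im \<tau>\<bar>"
  define c2 where "c2 = 1 / (1 + norm \<tau> / \<bar>Im \<tau>\<bar>)"
  have pos: "c1 > 0" "c2 > 0" using Im_ratio by (auto simp: c1_def c2_def \<tau>_def intro!: add_pos_nonneg)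
  have main: "min c1 c2 * max \<bar>x\<bar> \<bar>y\<bar> \<le> norm (of_real x + of_real y * \<tau>)" for x y
  proof -
    have 1: "c1 * \<bar>y\<bar> \<le> norm (of_real x + of_real y * \<tau>)"
      using abs_Im_le_cmod[of "of_real x + of_real y * \<tau>"] by (simp add: c1_def abs_mult mult.commute)
    have "\<bar>x\<bar> = norm ((of_real x + of_real y * \<tau>) - of_real y * \<tau>)" by simp
    also have "\<dots> \<le> norm (of_real x + of_real y * \<tau>) + \<bar>y\<bar> * norm \<tau>"
      by (metis norm_mult norm_of_real norm_triangle_ineq4)
    also have "\<dots> \<le> norm (of_real x + of_real y * \<tau>) + (norm (of_real x + of_real y * \<tau>) / c1) * norm \<tau>"
      using 1 pos by (intro add_left_mono mult_right_mono) (auto simp: field_simps)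
    also have "\<dots> = norm (of_real x + of_real y * \<tau>) / c2"
      by (simp add: c1_def c2_def algebra_simps)
    finally have 2: "c2 * \<bar>x\<bar> \<le> norm (of_real x + of_real y * \<tau>)"
      using pos by (simp add: field_simps)
    have "min c1 c2 * \<bar>x\<bar> \<le> c2 * \<bar>x\<bar>" "min c1 c2 * \<bar>y\<bar> \<le> c1 * \<bar>y\<bar>"
      by (intro mult_right_mono; simp)+
    then show ?thesis using 1 2 by (auto simp: max_def)
  qed
  show ?thesis
  proof (rule that[of "norm w1 * min c1 c2"])
    show "norm w1 * min c1 c2 > 0" using pos w_nonzero by auto
    fix x y
    have "of_real x * w1 + of_real y * w2 = w1 * (of_real x + of_real y * \<tau>)"
      using w_nonzero by (simp add: \<tau>_def algebra_simps)
    then show "norm w1 * min c1 c2 * max \<bar>x\<bar> \<bar>y\<bar> \<le> norm (of_real x * w1 + of_real y * w2)"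
      using mult_left_mono[OF main[of x y], of "norm w1"] by (simp add: norm_mult mult.assoc)
  qed
qed

lemma norm_lattice_ge_ht:
  obtains c where "c > 0" "\<And>mn. mn \<noteq> (0,0) \<Longrightarrow> c * ht mn \<le> norm (\<omega> mn)"
proof -
  obtain c where c: "c > 0" "\<And>x y. c * max \<bar>x\<bar> \<bar>y\<bar> \<le> norm (of_real x * w1 + of_real y * w2)"
    using norm_lincomb_ge by blast
  have "c / 2 * ht mn \<le> norm (\<omega> mn)" if "mn \<noteq> (0,0)" for mn
  proof -
    have "c / 2 * ht mn \<le> c / 2 * (2 * max \<bar>of_int (fst mn)\<bar> \<bar>of_int (snd mn)\<bar>)"
      using ht_le_max[OF that] c by (intro mult_left_mono) auto
    also have "\<dots> \<le> norm (\<omega> mn)" using c(2)[of "of_int (fst mn)" "of_int (snd mn)"] by (simp add: lattice_pt_def)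
    finally show ?thesis .
  qed
  with c(1) show ?thesis by (intro that[of "c/2"]) auto
qed

lemma lattice_pt_eq_0_iff: "\<omega> mn = 0 \<longleftrightarrow> mn = (0,0)"
proof -
  obtain c where "c > 0" "\<And>mn. mn \<noteq> (0,0) \<Longrightarrow> c * ht mn \<le> norm (\<omega> mn)"
    using norm_lattice_ge_ht by blast
  moreover have "0 < ht mn" using ht_ge_1[of mn] by linarith
  ultimately have "mn \<noteq> (0,0) \<Longrightarrow> norm (\<omega> mn) > 0" using mult_pos_pos order_less_le_trans by blast
  then show ?thesis by (auto simp: lattice_pt_def)
qed

lemma finite_lattice_norm_le: "finite {mn. norm (\<omega> mn) \<le> R}"
proof -
  obtain c where c: "c > 0" "\<And>x y. c * max \<bar>x\<bar> \<bar>y\<bar> \<le> norm (of_real x * w1 + of_real y * w2)"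
    using norm_lincomb_ge by blast
  define K where "K = \<lceil>R / c\<rceil>"
  have "{mn. norm (\<omega> mn) \<le> R} \<subseteq> {-K..K} \<times> {-K..K}"
  proof
    fix mn assume "mn \<in> {mn. norm (\<omega> mn) \<le> R}"
    then have "c * max \<bar>of_int (fst mn)\<bar> \<bar>of_int (snd mn)\<bar> \<le> R"
      using c(2)[of "of_int (fst mn)" "of_int (snd mn)"] by (simp add: lattice_pt_def)
    then have "max \<bar>of_int (fst mn)\<bar> \<bar>of_int (snd mn)\<bar> \<le> R / c"
      using c(1) by (subst pos_le_divide_eq) (auto simp only: mult.commute)
    then have "\<bar>fst mn\<bar> \<le> K" "\<bar>snd mn\<bar> \<le> K" unfolding K_def by linarith+
    then show "mn \<in> {-K..K} \<times> {-K..K}" by (cases mn) auto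
  qed
  then show ?thesis by (rule finite_subset) auto
qed

lemma lattice_add: "\<omega> mn + \<omega> mn' = \<omega> (fst mn + fst mn', snd mn + snd mn')"
  by (simp add: lattice_pt_def algebra_simps)

lemma lattice_uminus: "- \<omega> mn = \<omega> (- fst mn, - snd mn)"
  by (simp add: lattice_pt_def)

lemma Lambda_add: "a \<in> \<Lambda> \<Longrightarrow> b \<in> \<Lambda> \<Longrightarrow> a + b \<in> \<Lambda>"
  by (auto simp: lattice_add)

lemma Lambda_uminus: "a \<in> \<Lambda> \<Longrightarrow> - a \<in> \<Lambda>"
  by (auto simp: lattice_uminus)

lemma Lambda_uminus_iff: "- a \<in> \<Lambda> \<longleftrightarrow> a \<in> \<Lambda>"
  using Lambda_uminus[of a] Lambda_uminus[of "- a"] by auto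

lemma Lambda_add_iff: "b \<in> \<Lambda> \<Longrightarrow> a + b \<in> \<Lambda> \<longleftrightarrow> a \<in> \<Lambda>"
  using Lambda_add[of a b] Lambda_add[of "a + b" "- b"] Lambda_uminus[of b] by auto

lemma Lambda_diff_iff: "b \<in> \<Lambda> \<Longrightarrow> a - b \<in> \<Lambda> \<longleftrightarrow> a \<in> \<Lambda>"
  using Lambda_add_iff[of b "a - b"] by simp

lemma zero_in_Lambda: "0 \<in> \<Lambda>"
  by (rule range_eqI[of _ _ "(0,0)"]) (simp add: lattice_pt_def)

lemma w_in_Lambda: "w1 \<in> \<Lambda>" "w2 \<in> \<Lambda>"
  by (rule range_eqI[of _ _ "(1,0)"], simp add: lattice_pt_def)
     (rule range_eqI[of _ _ "(0,1)"], simp add: lattice_pt_def)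

text \<open>A quantitative form of the discreteness of the lattice, suited to the Weierstrass M-test.\<close>
lemma separation:
  assumes "z0 \<notin> \<omega> ` A"
  obtains r \<eta> where "r > 0" "\<eta> > 0"
    "\<And>z mn. z \<in> cball z0 r \<Longrightarrow> mn \<in> A \<Longrightarrow> \<eta> * norm (\<omega> mn) \<le> norm (\<omega> mn - z)"
    "\<And>z mn. z \<in> cball z0 r \<Longrightarrow> mn \<in> A \<Longrightarrow> \<eta> \<le> norm (\<omega> mn - z)"
proof -
  \<comment> \<open>Outside the radius \<open>\<rho>\<close> a lattice point has at least twice the
    norm of every \<open>z\<close> considered, so its distance to \<open>z\<close> is at least half
    its norm. Only finitely many points remain, and \<open>d\<close> takes care of them.\<close>
  define \<rho> where "\<rho> = 2 * (norm z0 + 1)"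
  have \<rho>: "\<rho> > 0" by (simp add: \<rho>_def add_nonneg_pos)
  define F where "F = {mn \<in> A. norm (\<omega> mn) \<le> \<rho>}"
  have fin: "finite F" unfolding F_def by (rule finite_subset[OF _ finite_lattice_norm_le[of \<rho>]]) auto
  define d where "d = Min (insert 1 ((\<lambda>mn. norm (\<omega> mn - z0)) ` F))"
  have d0: "d > 0" using fin assms by (auto simp: d_def F_def)
  have dF: "d \<le> norm (\<omega> mn - z0)" if "mn \<in> F" for mn
    using fin that by (auto simp: d_def)
  have d1: "d \<le> 1" using fin by (auto simp: d_def)
  define \<eta> where "\<eta> = min (1/2) (min (d / 2) (d / (2 * \<rho>)))"
  have \<eta>: "\<eta> > 0" using d0 \<rho> by (simp add: \<eta>_def)
  have "\<eta> * norm (\<omega> mn) \<le> norm (\<omega> mn - z) \<and> \<eta> \<le> norm (\<omega> mn - z)"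
    if z: "z \<in> cball z0 (d/2)" and mn: "mn \<in> A" for z mn
  proof (cases "mn \<in> F")
    case True
    have "norm (\<omega> mn - z0) \<le> norm (\<omega> mn - z) + norm (z - z0)"
      by (metis diff_add_cancel add_diff_eq norm_triangle_ineq)
    then have 1: "d / 2 \<le> norm (\<omega> mn - z)"
      using dF[OF True] z by (simp add: dist_norm norm_minus_commute)
    have "\<eta> * norm (\<omega> mn) \<le> d / (2 * \<rho>) * \<rho>"
      using True d0 \<rho> by (intro mult_mono) (auto simp: \<eta>_def F_def)
    then show ?thesis using 1 \<rho> by (auto simp: \<eta>_def)
  next
    case False
    then have big: "norm (\<omega> mn) > \<rho>" using mn by (auto simp: F_def)
    have "norm z \<le> norm z0 + 1" using z d1 norm_triangle_ineq2[of z z0]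
      by (simp add: dist_norm norm_minus_commute)
    then have "norm z \<le> norm (\<omega> mn) / 2" using big by (simp add: \<rho>_def)
    then have 1: "norm (\<omega> mn) / 2 \<le> norm (\<omega> mn - z)" using norm_triangle_ineq2[of "\<omega> mn" z] by linarith
    have "\<eta> * norm (\<omega> mn) \<le> 1/2 * norm (\<omega> mn)" by (intro mult_right_mono) (auto simp: \<eta>_def)
    moreover have "\<eta> \<le> 1/2" by (simp add: \<eta>_def)
    moreover have "1 \<le> norm (\<omega> mn) / 2" using big by (smt (verit) \<rho>_def field_sum_of_halves norm_ge_zero)
    ultimately show ?thesis using 1 by linarith
  qed
  with d0 \<eta> show ?thesis by (intro that[of "d/2" \<eta>]) auto
qed

lemma open_compl_lattice: "open (- \<omega> ` A)"
proof (rule Topological_Spaces.openI)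
  fix z0 assume "z0 \<in> - \<omega> ` A"
  then have "z0 \<notin> \<omega> ` A" by simp
  then show "\<exists>T. open T \<and> z0 \<in> T \<and> T \<subseteq> - \<omega> ` A"
  proof (rule separation)
    fix r \<eta> :: real
    assume r: "r > 0" "\<eta> > 0" "\<And>z mn. z \<in> cball z0 r \<Longrightarrow> mn \<in> A \<Longrightarrow> \<eta> \<le> norm (\<omega> mn - z)"
    have "z \<notin> \<omega> ` A" if "z \<in> ball z0 r" for z
    proof
      assume "z \<in> \<omega> ` A"
      then obtain mn where "mn \<in> A" "z = \<omega> mn" by auto
      then show False using r(3)[of z mn] r(2) that by auto
    qed
    then have "ball z0 r \<subseteq> - \<omega> ` A" by blast
    with r(1) show "\<exists>T. open T \<and> z0 \<in> T \<and> T \<subseteq> - \<omega> ` A" by (metis centre_in_ball open_ball)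
  qed
qed

lemma connected_compl_Lambda: "connected (- \<Lambda>)"
  unfolding Compl_eq_Diff_UNIV
  by (rule connected_open_diff_countable) (auto simp: connected_UNIV)

end

section \<open>Laurent expansion and periodicity of the Weierstrass function\<close>

text \<open>An unconditional sum may be computed along the symmetric intervals
  \<open>{-k..k}\<close>, where it telescopes to \<open>h (-k-1) - h k\<close>.\<close>

lemma has_sum_telescoping_int:
  fixes h :: "int \<Rightarrow> complex"
  assumes s: "(\<lambda>m. h (m - 1) - h m) summable_on UNIV"
    and lim1: "(\<lambda>k. h (int k)) \<longlonglongrightarrow> 0" and lim2: "(\<lambda>k. h (- int k)) \<longlonglongrightarrow> 0"
  shows "((\<lambda>m. h (m - 1) - h m) has_sum 0) UNIV"
proof -
  have sum: "(\<Sum>m\<in>{- int k..int k}. h (m - 1) - h m) = h (- int (Suc k)) - h (int k)" for k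
  proof (induction k)
    case 0
    then show ?case by simp
  next
    case (Suc k)
    have "{- int (Suc k)..int (Suc k)} = insert (int (Suc k)) (insert (- int (Suc k)) {- int k..int k})"
      by auto
    then show ?case using Suc by (simp add: algebra_simps)
  qed
  obtain S where S: "((\<lambda>m. h (m - 1) - h m) has_sum S) UNIV"
    using s by (auto simp: summable_on_def)
  have "filterlim (\<lambda>k. {- int k..int k}) (finite_subsets_at_top UNIV) sequentially"
    unfolding filterlim_finite_subsets_at_top
  proof (intro allI impI, safe)
    fix X :: "int set" assume "finite X"
    then have bX: "\<bar>x\<bar> \<le> Max (insert 0 (abs ` X))" if "x \<in> X" for x
      using that by (intro Max_ge) auto
    show "\<forall>\<^sub>F k in sequentially. finite {- int k..int k} \<and> X \<subseteq> {- int k..int k} \<and> {- int k..int k} \<subseteq> UNIV"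
      using eventually_ge_at_top[of "nat (Max (insert 0 (abs ` X)))"]
    proof eventually_elim
      case (elim k)
      have "x \<in> {- int k..int k}" if "x \<in> X" for x using bX[OF that] elim by auto
      then show ?case by auto
    qed
  qed
  with S have "(\<lambda>k. \<Sum>m\<in>{- int k..int k}. h (m - 1) - h m) \<longlonglongrightarrow> S"
    unfolding has_sum_def by (rule filterlim_compose)
  moreover have "(\<lambda>k. \<Sum>m\<in>{- int k..int k}. h (m - 1) - h m) \<longlonglongrightarrow> 0 - 0"
    unfolding sum by (intro tendsto_diff lim1 LIMSEQ_Suc[OF lim2])
  ultimately have "S = 0" using LIMSEQ_unique by fastforce
  with S show ?thesis by simp
qed

lemma tendsto_inverse_square_arith:
  fixes a b :: complex
  assumes "a \<noteq> 0"
  shows "(\<lambda>k. 1 / (b - of_nat k * a)\<^sup>2) \<longlonglongrightarrow> 0"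
proof -
  have "filterlim (\<lambda>k. (- a) * of_nat k) at_infinity sequentially"
    using assms by (intro tendsto_mult_filterlim_at_infinity[OF tendsto_const] tendsto_of_nat) auto
  then have "filterlim (\<lambda>k. b + (- a) * of_nat k) at_infinity sequentially"
    by (rule tendsto_add_filterlim_at_infinity[OF tendsto_const])
  then have "(\<lambda>k. inverse (b + (- a) * of_nat k)) \<longlonglongrightarrow> 0"
    by (rule filterlim_compose[OF tendsto_inverse_0])
  then have "(\<lambda>k. (inverse (b + (- a) * of_nat k))\<^sup>2) \<longlonglongrightarrow> 0\<^sup>2"
    by (intro tendsto_power)
  then show ?thesis by (simp add: divide_inverse power_inverse mult.commute)
qed

lemma lattice_pt_swap: "lattice_pt w2 w1 (n, m) = lattice_pt w1 w2 (m, n)"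
  by (simp add: lattice_pt_def)

lemma wp_lattice_swap: "wp_lattice w2 w1 = wp_lattice w1 w2"
proof
  fix z
  have "bij_betw (\<lambda>(m::int,n::int). (n,m)) (UNIV - {(0,0)}) (UNIV - {(0,0)})"
    by (rule bij_betwI[of _ _ _ "\<lambda>(m,n). (n,m)"]) auto
  from infsum_reindex_bij_betw[OF this, of "\<lambda>mn. 1 / (z - lattice_pt w2 w1 mn)\<^sup>2 - 1 / (lattice_pt w2 w1 mn)\<^sup>2"]
  show "wp_lattice w2 w1 z = wp_lattice w1 w2 z"
    by (simp add: wp_lattice_def case_prod_unfold lattice_pt_swap)
qed

context complex_lattice
begin

lemma swapped: "complex_lattice w2 w1"
proof
  show "Im (w1 / w2) \<noteq> 0"
  proof
    assume "Im (w1 / w2) = 0"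
    then have "w1 / w2 = of_real (Re (w1 / w2))" by (simp add: complex_eq_iff)
    then have "w2 / w1 = of_real (1 / Re (w1 / w2))"
      by (metis divide_divide_eq_right mult_1 of_real_1 of_real_divide)
    then show False using Im_ratio by (metis Im_complex_of_real)
  qed
qed

abbreviation wp :: "complex \<Rightarrow> complex" where "wp \<equiv> wp_lattice w1 w2"

abbreviation \<Lambda>0 :: "complex set" where "\<Lambda>0 \<equiv> \<omega> ` (UNIV - {(0,0)})"

lemma Lambda0_eq: "\<Lambda>0 = \<Lambda> - {0}"
  using lattice_pt_eq_0_iff by (auto simp: image_iff)

text \<open>The Eisenstein sums: \<open>g2_lattice\<close> is \<open>60 * G 4\<close> and
  \<open>g3_lattice\<close> is \<open>140 * G 6\<close>.\<close>

definition G :: "nat \<Rightarrow> complex" where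
  "G k = infsum (\<lambda>mn. 1 / \<omega> mn ^ k) (UNIV - {(0,0)})"

lemma summable_on_G:
  assumes "k \<ge> 3"
  shows "(\<lambda>mn. 1 / \<omega> mn ^ k) summable_on (UNIV - {(0,0)})"
proof -
  obtain c where c: "c > 0" "\<And>mn. mn \<noteq> (0,0) \<Longrightarrow> c * ht mn \<le> norm (\<omega> mn)"
    using norm_lattice_ge_ht by blast
  show ?thesis
  proof (rule summable_on_dominated_ht)
    fix mn :: "int \<times> int" assume "mn \<in> UNIV - {(0,0)}"
    then have 1: "c * ht mn \<le> norm (\<omega> mn)" using c by auto
    have "c * 1 \<le> c * ht mn" using c ht_ge_1 by (intro mult_left_mono) auto
    with 1 have 2: "c \<le> norm (\<omega> mn)" by simp
    have "norm (1 / \<omega> mn ^ k) = 1 / norm (\<omega> mn) ^ (k - 3) * (1 / norm (\<omega> mn) ^ 3)"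
      using assms by (simp add: norm_divide norm_power flip: power_add)
    also have "\<dots> \<le> 1 / c ^ (k - 3) * ((1 / c ^ 3) * (1 / ht mn ^ 3))"
      using c(1) 1 2 by (intro mult_mono inverse_cube_le) (auto intro!: divide_left_mono power_mono mult_pos_pos zero_less_power)
    finally show "norm (1 / \<omega> mn ^ k) \<le> (1 / c ^ (k - 3) * (1 / c ^ 3)) * (1 / ht mn ^ 3)"
      by (simp add: mult.assoc)
  qed
qed

lemma G_odd_eq_0:
  assumes "k \<ge> 3" "odd k"
  shows "G k = 0"
proof (rule has_sum_odd_eq_0)
  show "((\<lambda>mn. 1 / \<omega> mn ^ k) has_sum G k) (UNIV - {(0,0)})"
    unfolding G_def using summable_on_G[OF assms(1)] by (rule has_sum_infsum)
  show "1 / \<omega> (- m, - n) ^ k = - (1 / \<omega> (m, n) ^ k)" for m n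
    using lattice_uminus[of "(m,n)", symmetric] assms(2) by (simp add: power_minus_odd)
qed

text \<open>Multiplied by \<open>z^5\<close>, this is the exact remainder of the Taylor polynomial
  of degree 4 in \<open>z\<close> of \<open>1/(w - z)^2 - 1/w^2\<close>. A closed remainder yields
  the Laurent expansion to the order required without rearranging a double series.\<close>

definition wp_rem_term :: "complex \<Rightarrow> complex \<Rightarrow> complex" where
  "wp_rem_term z w = (6 * w - 5 * z) / (w ^ 6 * (w - z)\<^sup>2)"

definition wp_rem :: "complex \<Rightarrow> complex" where
  "wp_rem z = infsum (\<lambda>mn. wp_rem_term z (\<omega> mn)) (UNIV - {(0,0)})"

text \<open>The term decays like the seventh power of \<open>1 / norm (\<omega> mn)\<close>, locally
  uniformly in \<open>z\<close> by \<open>separation\<close>. Four of these powers are bounded by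
  \<open>1/c^4\<close>, and the other three are compared with \<open>1 / ht^3\<close>.\<close>

lemma wp_rem_term_bound:
  assumes "z0 \<notin> \<Lambda>0"
  obtains r C where "r > 0"
    "\<And>z mn. z \<in> cball z0 r \<Longrightarrow> mn \<noteq> (0,0) \<Longrightarrow> norm (wp_rem_term z (\<omega> mn)) \<le> C * (1 / ht mn ^ 3)"
    "cball z0 r \<inter> \<Lambda>0 = {}"
proof -
  obtain c where c: "c > 0" "\<And>mn. mn \<noteq> (0,0) \<Longrightarrow> c * ht mn \<le> norm (\<omega> mn)"
    using norm_lattice_ge_ht by blast
  obtain r \<eta> where r: "r > 0" "\<eta> > 0"
    "\<And>z mn. z \<in> cball z0 r \<Longrightarrow> mn \<in> UNIV - {(0,0)} \<Longrightarrow> \<eta> * norm (\<omega> mn) \<le> norm (\<omega> mn - z)"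
    "\<And>z mn. z \<in> cball z0 r \<Longrightarrow> mn \<in> UNIV - {(0,0)} \<Longrightarrow> \<eta> \<le> norm (\<omega> mn - z)"
    using separation[OF assms] by blast
  define R where "R = norm z0 + r"
  define K where "K = (6 + 5 * R / c) / (\<eta>\<^sup>2 * c ^ 4)"
  have "norm (wp_rem_term z (\<omega> mn)) \<le> (K / c ^ 3) * (1 / ht mn ^ 3)"
    if z: "z \<in> cball z0 r" and mn: "mn \<noteq> (0,0)" for z mn
  proof -
    define a where "a = norm (\<omega> mn)"
    have 1: "c * ht mn \<le> a" using c mn by (auto simp: a_def)
    have "c * 1 \<le> c * ht mn" using c ht_ge_1 by (intro mult_left_mono) auto
    with 1 have 2: "c \<le> a" by simp
    with c have a: "a > 0" by simp
     have "norm z \<le> R" using z norm_triangle_sub[of z z0] by (auto simp: R_def dist_norm norm_minus_commute)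
    moreover have "R \<ge> 0" using r by (simp add: R_def)
    moreover have "R * c \<le> R * a" using 2 \<open>R \<ge> 0\<close> by (intro mult_left_mono)
    moreover have "norm z * c \<le> R * c" using \<open>norm z \<le> R\<close> c(1) by (intro mult_right_mono) auto
    ultimately have "norm z * c \<le> R * a" by linarith
    then have "norm z \<le> R / c * a" using c(1) by (simp add: field_simps)
    moreover have "norm (6 * \<omega> mn - 5 * z) \<le> 6 * a + 5 * norm z"
      unfolding a_def by (rule order_trans[OF norm_triangle_ineq4]) (simp add: norm_mult)
    ultimately have num: "norm (6 * \<omega> mn - 5 * z) \<le> (6 + 5 * R / c) * a"
      by (simp add: distrib_right)
    have den: "a ^ 6 * (\<eta> * a)\<^sup>2 \<le> norm (\<omega> mn ^ 6 * (\<omega> mn - z)\<^sup>2)"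
      unfolding norm_mult norm_power a_def[symmetric] using r z mn a
      by (intro mult_left_mono power_mono) (auto simp: a_def)
    have "norm (wp_rem_term z (\<omega> mn)) \<le> ((6 + 5 * R / c) * a) / (a ^ 6 * (\<eta> * a)\<^sup>2)"
      unfolding wp_rem_term_def norm_divide using order_trans[OF norm_ge_zero num] num den a r(2)
      by (intro frac_le) auto
    also have "\<dots> = (6 + 5 * R / c) / \<eta>\<^sup>2 * (1 / a ^ 4) * (1 / a ^ 3)"
      using a by (simp add: divide_simps eval_nat_numeral)
    also have "\<dots> \<le> (6 + 5 * R / c) / \<eta>\<^sup>2 * (1 / c ^ 4) * (1 / a ^ 3)"
      using a 2 c \<open>R \<ge> 0\<close> r
      by (intro mult_right_mono mult_left_mono divide_left_mono power_mono) (auto intro!: mult_pos_pos)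
    also have "\<dots> = K * (1 / a ^ 3)" by (simp add: K_def)
    also have "\<dots> \<le> K * ((1 / c ^ 3) * (1 / ht mn ^ 3))"
      using 1 c \<open>R \<ge> 0\<close> by (intro mult_left_mono inverse_cube_le) (auto simp: K_def)
    finally show ?thesis by simp
  qed
  moreover have "\<omega> mn \<notin> cball z0 r" if "mn \<in> UNIV - {(0,0)}" for mn
    using r(2) r(4)[of "\<omega> mn" mn] that by auto
  then have "cball z0 r \<inter> \<Lambda>0 = {}" by blast
  ultimately show ?thesis using r(1) by (intro that[of r "K / c ^ 3"]) blast+
qed

lemma summable_on_wp_rem:
  assumes "z \<notin> \<Lambda>0"
  shows "(\<lambda>mn. wp_rem_term z (\<omega> mn)) summable_on (UNIV - {(0,0)})"
proof (rule wp_rem_term_bound[OF assms])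
  fix r C
  assume "r > 0" and b: "\<And>z' mn. z' \<in> cball z r \<Longrightarrow> mn \<noteq> (0,0) \<Longrightarrow> norm (wp_rem_term z' (\<omega> mn)) \<le> C * (1 / ht mn ^ 3)"
  show ?thesis by (rule summable_on_dominated_ht[of _ _ C]) (use b[of z] \<open>r > 0\<close> in auto)
qed

lemma holomorphic_wp_rem: "wp_rem holomorphic_on - \<Lambda>0"
proof -
  have "wp_rem field_differentiable at z0" if "z0 \<in> - \<Lambda>0" for z0
  proof -
    have z0: "z0 \<notin> \<Lambda>0" using that by simp
    obtain r C where r: "r > 0"
      "\<And>z mn. z \<in> cball z0 r \<Longrightarrow> mn \<noteq> (0,0) \<Longrightarrow> norm (wp_rem_term z (\<omega> mn)) \<le> C * (1 / ht mn ^ 3)"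
      "cball z0 r \<inter> \<Lambda>0 = {}"
      using wp_rem_term_bound[OF z0] by blast
    have hol: "(\<lambda>z. \<Sum>mn\<in>X. wp_rem_term z (\<omega> mn)) holomorphic_on cball z0 r" if "X \<subseteq> UNIV - {(0,0)}" for X
      unfolding wp_rem_term_def
      by (intro holomorphic_intros) (use that r(3) in \<open>auto simp: lattice_pt_eq_0_iff\<close>)
    have "wp_rem holomorphic_on ball z0 r"
    proof (rule holomorphic_uniform_limit)
      show "uniform_limit (cball z0 r) (\<lambda>X z. \<Sum>mn\<in>X. wp_rem_term z (\<omega> mn)) wp_rem
              (finite_subsets_at_top (UNIV - {(0,0)}))"
        unfolding wp_rem_def
        by (rule Weierstrass_m_test_general[OF _ summable_on_cmult_right[OF summable_on_inverse_ht_cube, of C]])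
           (use r(2) in auto)
      show "\<forall>\<^sub>F X in finite_subsets_at_top (UNIV - {(0,0)}).
         continuous_on (cball z0 r) (\<lambda>z. \<Sum>mn\<in>X. wp_rem_term z (\<omega> mn)) \<and>
         (\<lambda>z. \<Sum>mn\<in>X. wp_rem_term z (\<omega> mn)) holomorphic_on ball z0 r"
      proof (rule eventually_finite_subsets_at_top_weakI)
        fix X :: "(int \<times> int) set" assume "X \<subseteq> UNIV - {(0,0)}"
        from hol[OF this] show "continuous_on (cball z0 r) (\<lambda>z. \<Sum>mn\<in>X. wp_rem_term z (\<omega> mn)) \<and>
          (\<lambda>z. \<Sum>mn\<in>X. wp_rem_term z (\<omega> mn)) holomorphic_on ball z0 r"
          by (auto intro: holomorphic_on_imp_continuous_on holomorphic_on_subset[OF _ ball_subset_cball])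
      qed
    qed auto
    then show ?thesis using r(1) by (meson centre_in_ball holomorphic_on_imp_differentiable_at open_ball)
  qed
  then show ?thesis by (auto simp: holomorphic_on_def field_differentiable_at_within)
qed

text \<open>Summing the Taylor identity over the lattice also produces terms in \<open>z\<close> and
  \<open>z^3\<close>; their coefficients are multiples of \<open>G 3\<close> and \<open>G 5\<close>,
  which vanish by the symmetry of the lattice.\<close>

lemma has_sum_wp_expansion:
  assumes z: "z \<notin> \<Lambda>0"
  shows "((\<lambda>mn. 1 / (z - \<omega> mn)\<^sup>2 - 1 / (\<omega> mn)\<^sup>2) has_sum
            (3 * G 4 * z\<^sup>2 + 5 * G 6 * z ^ 4 + z ^ 5 * wp_rem z)) (UNIV - {(0,0)})"
proof -
  have G: "((\<lambda>mn. 1 / \<omega> mn ^ k) has_sum G k) (UNIV - {(0,0)})" if "k \<ge> 3" for k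
    unfolding G_def using summable_on_G[OF that] by simp
  have rem: "((\<lambda>mn. wp_rem_term z (\<omega> mn)) has_sum wp_rem z) (UNIV - {(0,0)})"
    unfolding wp_rem_def using summable_on_wp_rem[OF z] by simp
  have A: "((\<lambda>mn. 2 * z * (1 / \<omega> mn ^ 3) + 3 * z\<^sup>2 * (1 / \<omega> mn ^ 4) + 4 * z ^ 3 * (1 / \<omega> mn ^ 5)
            + 5 * z ^ 4 * (1 / \<omega> mn ^ 6) + z ^ 5 * wp_rem_term z (\<omega> mn)) has_sum
          (2 * z * G 3 + 3 * z\<^sup>2 * G 4 + 4 * z ^ 3 * G 5 + 5 * z ^ 4 * G 6 + z ^ 5 * wp_rem z)) (UNIV - {(0,0)})"
    by (intro has_sum_add has_sum_cmult_right G rem) auto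
  have B: "2 * z * (1 / \<omega> mn ^ 3) + 3 * z\<^sup>2 * (1 / \<omega> mn ^ 4) + 4 * z ^ 3 * (1 / \<omega> mn ^ 5)
            + 5 * z ^ 4 * (1 / \<omega> mn ^ 6) + z ^ 5 * wp_rem_term z (\<omega> mn) = 1 / (z - \<omega> mn)\<^sup>2 - 1 / (\<omega> mn)\<^sup>2"
    if mn: "mn \<in> UNIV - {(0,0)}" for mn
  proof -
    define w where "w = \<omega> mn"
    have w: "w \<noteq> 0" "w - z \<noteq> 0" using z mn by (auto simp: w_def lattice_pt_eq_0_iff)
    have "2 * z * (1 / w ^ 3) + 3 * z\<^sup>2 * (1 / w ^ 4) + 4 * z ^ 3 * (1 / w ^ 5) + 5 * z ^ 4 * (1 / w ^ 6)
        + z ^ 5 * ((6 * w - 5 * z) / (w ^ 6 * (w - z)\<^sup>2)) = 1 / (w - z)\<^sup>2 - 1 / w\<^sup>2"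
      using w by (simp add: divide_simps) algebra
    then show ?thesis by (simp add: w_def power2_commute[of z] wp_rem_term_def)
  qed
  show ?thesis
    using A by (subst (asm) has_sum_cong[OF B]) (simp_all add: G_odd_eq_0 mult.commute mult.left_commute)
qed

lemma wp_expansion:
  assumes "z \<notin> \<Lambda>0"
  shows "wp z = 1 / z\<^sup>2 + 3 * G 4 * z\<^sup>2 + 5 * G 6 * z ^ 4 + z ^ 5 * wp_rem z"
  using infsumI[OF has_sum_wp_expansion[OF assms]] by (simp add: wp_lattice_def)

lemma holomorphic_wp: "wp holomorphic_on - \<Lambda>"
proof -
  have sub: "- \<Lambda> \<subseteq> - \<Lambda>0" by auto
  have "(\<lambda>z. 1 / z\<^sup>2 + 3 * G 4 * z\<^sup>2 + 5 * G 6 * z ^ 4 + z ^ 5 * wp_rem z) holomorphic_on - \<Lambda>"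
    using zero_in_Lambda by (intro holomorphic_intros holomorphic_on_subset[OF holomorphic_wp_rem sub]) auto
  then show ?thesis
  proof (rule holomorphic_transform)
    fix z assume "z \<in> - \<Lambda>"
    then have "z \<notin> \<Lambda>0" using sub by blast
    then show "1 / z\<^sup>2 + 3 * G 4 * z\<^sup>2 + 5 * G 6 * z ^ 4 + z ^ 5 * wp_rem z = wp z"
      by (rule wp_expansion[symmetric])
  qed
qed

text \<open>The corrections \<open>1 / \<omega>^2\<close> cancel in the difference, and the
  principal parts become the term at the origin. The sum thus extends over the whole lattice, where
  translations can act on the indices.\<close>

lemma has_sum_wp_diff:
  assumes "z \<notin> \<Lambda>" "z' \<notin> \<Lambda>"
  shows "((\<lambda>mn. 1 / (z - \<omega> mn)\<^sup>2 - 1 / (z' - \<omega> mn)\<^sup>2) has_sum (wp z - wp z')) UNIV"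
proof -
  have *: "((\<lambda>mn. 1 / (z - \<omega> mn)\<^sup>2 - 1 / (\<omega> mn)\<^sup>2) has_sum (wp z - 1 / z\<^sup>2)) (UNIV - {(0,0)})" if "z \<notin> \<Lambda>" for z
  proof -
    have "z \<notin> \<Lambda>0" using that by auto
    then show ?thesis using has_sum_wp_expansion[of z] wp_expansion[of z] by (simp add: add.assoc)
  qed
  have "((\<lambda>mn. (1 / (z - \<omega> mn)\<^sup>2 - 1 / (\<omega> mn)\<^sup>2) - (1 / (z' - \<omega> mn)\<^sup>2 - 1 / (\<omega> mn)\<^sup>2)) has_sum
          ((wp z - 1 / z\<^sup>2) - (wp z' - 1 / z'\<^sup>2))) (UNIV - {(0,0)})"
    unfolding diff_conv_add_uminus[of _ "1 / (z' - _)\<^sup>2 - _"] diff_conv_add_uminus[of _ "wp z' - _"]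
    by (intro has_sum_add has_sum_uminusI * assms)
  then have "((\<lambda>mn. 1 / (z - \<omega> mn)\<^sup>2 - 1 / (z' - \<omega> mn)\<^sup>2) has_sum
          ((wp z - 1 / z\<^sup>2) - (wp z' - 1 / z'\<^sup>2))) (UNIV - {(0,0)})" by simp
  from has_sum_insert[OF _ this, of "(0,0)"] show ?thesis
    by (simp add: lattice_pt_def insert_UNIV)
qed

lemma wp_minus: "wp (- z) = wp z"
proof -
  have "bij_betw (\<lambda>(m::int,n::int). (-m,-n)) (UNIV - {(0,0)}) (UNIV - {(0,0)})"
    by (rule bij_betwI[of _ _ _ "\<lambda>(m,n). (-m,-n)"]) auto
  note infsum_reindex_bij_betw[OF this, of "\<lambda>mn. 1 / (z - \<omega> mn)\<^sup>2 - 1 / (\<omega> mn)\<^sup>2"]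
  moreover have "(z - - w)\<^sup>2 = (- z - w)\<^sup>2" for w :: complex by algebra
  ultimately show ?thesis
    by (simp add: wp_lattice_def case_prod_unfold lattice_uminus[symmetric])
qed

text \<open>Translation by \<open>w1\<close> lowers the index \<open>m\<close> by one, so for each
  fixed \<open>n\<close> the difference series telescopes to \<open>0\<close>. The pairs are
  exchanged in \<open>F\<close> so that \<open>m\<close> becomes the inner summation index.\<close>

lemma wp_add_w1:
  assumes z: "z \<notin> \<Lambda>"
  shows "wp (z + w1) = wp z"
proof -
  define F where "F = (\<lambda>(n,m). 1 / (z - \<omega> (m - 1, n))\<^sup>2 - 1 / (z - \<omega> (m, n))\<^sup>2)"
  have zw: "z + w1 \<notin> \<Lambda>" using z Lambda_add_iff[OF w_in_Lambda(1)] by simp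
  have 1: "(F has_sum (wp (z + w1) - wp z)) (UNIV \<times> UNIV)"
  proof -
    have "((\<lambda>mn. 1 / (z + w1 - \<omega> mn)\<^sup>2 - 1 / (z - \<omega> mn)\<^sup>2) has_sum (wp (z + w1) - wp z)) UNIV"
      using has_sum_wp_diff[OF zw z] .
    then show ?thesis unfolding UNIV_Times_UNIV
      by (subst has_sum_reindex_bij_witness[of _ "\<lambda>(m,n). (n,m)" "\<lambda>(m,n). (n,m)"])
         (auto simp: F_def lattice_pt_def algebra_simps)
  qed
  have 2: "((\<lambda>m. F (n, m)) has_sum 0) UNIV" for n
  proof -
    have s: "(\<lambda>m. F (n, m)) summable_on UNIV"
      by (rule summable_on_SigmaD1[of "\<lambda>n m. F (n, m)" UNIV "\<lambda>_. UNIV"]) (use 1 in \<open>auto simp: summable_on_def\<close>)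
    define h where "h = (\<lambda>m. 1 / (z - \<omega> (m, n))\<^sup>2)"
    have "(\<lambda>k. 1 / (z - of_int n * w2 - of_nat k * w1)\<^sup>2) \<longlonglongrightarrow> 0"
         "(\<lambda>k. 1 / (z - of_int n * w2 - of_nat k * (- w1))\<^sup>2) \<longlonglongrightarrow> 0"
      using w_nonzero by (intro tendsto_inverse_square_arith; simp)+
    then have "((\<lambda>m. h (m - 1) - h m) has_sum 0) UNIV" using s
      by (intro has_sum_telescoping_int) (simp_all add: h_def F_def lattice_pt_def algebra_simps)
    then show ?thesis by (simp add: F_def h_def)
  qed
  have "((\<lambda>n::int. 0) has_sum (wp (z + w1) - wp z)) UNIV"
    by (rule has_sum_SigmaD[OF 1]) (use 2 in auto)
  then have "wp (z + w1) - wp z = 0" by (metis has_sum_0 has_sum_unique)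
  then show ?thesis by simp
qed

lemma wp_add_w2:
  assumes z: "z \<notin> \<Lambda>"
  shows "wp (z + w2) = wp z"
proof -
  interpret S: complex_lattice w2 w1 by (rule swapped)
  have "range (lattice_pt w2 w1) = range (\<lambda>mn. \<omega> (prod.swap mn))"
    by (simp add: lattice_pt_def add.commute)
  also have "\<dots> = \<omega> ` range prod.swap" by (rule image_image[symmetric])
  finally have "range (lattice_pt w2 w1) = \<Lambda>" by simp
  then show ?thesis using S.wp_add_w1[of z] z by (simp add: wp_lattice_swap)
qed

end

section \<open>Elliptic functions without poles and the differential equation\<close>

text \<open>Evenness forces \<open>deriv g 0 = 0\<close>, so the zero at the origin is at least
  double and two divided differences remain holomorphic.\<close>

lemma even_double_zero_quotient:
  fixes g :: "complex \<Rightarrow> complex"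
  assumes hol: "g holomorphic_on ball 0 r" and r: "r > 0" and g0: "g 0 = 0"
    and even: "\<And>z. z \<in> ball 0 r \<Longrightarrow> g (- z) = g z"
  obtains c where "((\<lambda>z. g z / z\<^sup>2) \<longlongrightarrow> c) (at 0)"
proof -
  have int0: "0 \<in> interior (ball 0 r)" using r by simp
  have "(g has_field_derivative deriv g 0) (at 0)"
    using hol r by (simp add: holomorphic_derivI)
  then have "((\<lambda>z. g (- z)) has_field_derivative - deriv g 0) (at 0)"
    using DERIV_chain2[of g "deriv g 0" "\<lambda>z. - z" 0 "-1"] by (simp add: DERIV_minus)
  moreover have "((\<lambda>z. g (- z)) has_field_derivative deriv g 0) (at 0)"
    by (rule has_field_derivative_transform_within[OF \<open>(g has_field_derivative deriv g 0) (at 0)\<close> r])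
       (use even in \<open>auto simp: dist_norm\<close>)
  ultimately have "- deriv g 0 = deriv g 0" by (rule DERIV_unique)
  then have d0: "deriv g 0 = 0" by simp
  define g1 where "g1 = (\<lambda>z. if z = 0 then deriv g 0 else (g z - g 0) / (z - 0))"
  have g1: "g1 holomorphic_on ball 0 r" unfolding g1_def by (rule pole_lemma[OF hol int0])
  define g2 where "g2 = (\<lambda>z. if z = 0 then deriv g1 0 else (g1 z - g1 0) / (z - 0))"
  have "g2 holomorphic_on ball 0 r" unfolding g2_def by (rule pole_lemma[OF g1 int0])
  then have "continuous_on (ball 0 r) g2" by (rule holomorphic_on_imp_continuous_on)
  then have "isCont g2 0" using r by (simp add: continuous_on_eq_continuous_at)
  then have "(g2 \<longlongrightarrow> g2 0) (at 0)" by (simp add: isCont_def)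
  then have "((\<lambda>z. g z / z\<^sup>2) \<longlongrightarrow> g2 0) (at 0)"
    by (rule Lim_transform_within[OF _ r]) (simp add: g2_def g1_def d0 g0 power2_eq_square)
  then show ?thesis by (rule that)
qed

context complex_lattice
begin

lemma lincomb_eq_0:
  assumes "of_real x * w1 + of_real y * w2 = 0"
  shows "x = 0" "y = 0"
proof -
  obtain c where "c > 0" "\<And>x y. c * max \<bar>x\<bar> \<bar>y\<bar> \<le> norm (of_real x * w1 + of_real y * w2)"
    using norm_lincomb_ge by blast
  then have "c * max \<bar>x\<bar> \<bar>y\<bar> \<le> 0" using assms by (metis norm_zero)
  then have "max \<bar>x\<bar> \<bar>y\<bar> \<le> 0" using \<open>c > 0\<close> by (simp add: mult_le_0_iff del: max_less_iff_conj)
  then show "x = 0" "y = 0" by auto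
qed

lemma lincomb_ex: "\<exists>x y. z = of_real x * w1 + of_real y * w2"
proof -
  define \<tau> where "\<tau> = w2 / w1"
  define y where "y = Im (z / w1) / Im \<tau>"
  define x where "x = Re (z / w1 - of_real y * \<tau>)"
  have "Im \<tau> \<noteq> 0" using Im_ratio by (simp add: \<tau>_def)
  then have "z / w1 - of_real y * \<tau> = of_real x" by (simp add: complex_eq_iff x_def y_def)
  then have "z / w1 = of_real x + of_real y * \<tau>" by (simp add: algebra_simps)
  then have "z = (of_real x + of_real y * \<tau>) * w1" using w_nonzero by (simp add: nonzero_divide_eq_eq)
  then have "z = of_real x * w1 + of_real y * w2" using w_nonzero by (simp add: \<tau>_def algebra_simps)
  then show ?thesis by blast
qed

lemma periodic_generators:
  assumes 1: "\<And>z. z \<notin> \<Lambda> \<Longrightarrow> f (z + w1) = f z" and 2: "\<And>z. z \<notin> \<Lambda> \<Longrightarrow> f (z + w2) = f z"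
    and z: "z \<notin> \<Lambda>" and w: "w \<in> \<Lambda>"
  shows "f (z + w) = f z"
proof -
  have step: "f (z + of_int m * a) = f z"
    if a: "a \<in> \<Lambda>" and per: "\<And>z. z \<notin> \<Lambda> \<Longrightarrow> f (z + a) = f z" and z: "z \<notin> \<Lambda>" for m z a
  proof -
    have nl: "z + of_int i * a \<notin> \<Lambda>" for i
    proof -
      obtain mn where "a = \<omega> mn" using a by auto
      then have "of_int i * a = \<omega> (i * fst mn, i * snd mn)" by (simp add: lattice_pt_def algebra_simps)
      then have "of_int i * a \<in> \<Lambda>" by auto
      then show ?thesis using z Lambda_add_iff by blast
    qed
    show ?thesis
    proof (induction m rule: int_induct[of _ 0])
      case base
      then show ?case by simp
    next
      case (step1 i)
      then show ?case using per[OF nl[of i]] by (simp add: algebra_simps)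
    next
      case (step2 i)
      then show ?case using per[OF nl[of "i - 1"]] by (simp add: algebra_simps)
    qed
  qed
  obtain m n where mn: "w = of_int m * w1 + of_int n * w2" using w by (auto simp: lattice_pt_def)
  have "of_int m * w1 \<in> \<Lambda>" by (rule range_eqI[of _ _ "(m,0)"]) (simp add: lattice_pt_def)
  then have "z + of_int m * w1 \<notin> \<Lambda>" using z Lambda_add_iff by blast
  from step[OF w_in_Lambda(2) 2 this, of n] step[OF w_in_Lambda(1) 1 z, of m]
  show ?thesis by (simp add: mn add.assoc)
qed

lemma wp_periodic: "z \<notin> \<Lambda> \<Longrightarrow> w \<in> \<Lambda> \<Longrightarrow> wp (z + w) = wp z"
  by (rule periodic_generators) (auto intro: wp_add_w1 wp_add_w2)

lemma punctured_ball_avoids_Lambda: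
  obtains e where "e > 0" "ball 0 e - {0} \<subseteq> - \<Lambda>" "ball 0 e \<subseteq> - \<Lambda>0"
proof -
  have "0 \<in> - \<Lambda>0" by (auto simp: lattice_pt_eq_0_iff)
  then obtain e where e: "e > 0" "ball 0 e \<subseteq> - \<Lambda>0"
    by (rule openE[OF open_compl_lattice])
  then have "ball 0 e - {0} \<subseteq> - \<Lambda>" unfolding Lambda0_eq by blast
  with e show ?thesis by (intro that[of e])
qed

text \<open>Periodicity carries the removable singularity at \<open>0\<close> to every lattice
  point, giving an entire function. All its values occur on a compact period parallelogram, so
  Liouville's theorem applies.\<close>

lemma elliptic_constant:
  assumes hol: "f holomorphic_on - \<Lambda>"
    and per: "\<And>z. z \<notin> \<Lambda> \<Longrightarrow> f (z + w1) = f z" "\<And>z. z \<notin> \<Lambda> \<Longrightarrow> f (z + w2) = f z"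
    and lim: "(f \<longlongrightarrow> l) (at 0)" and z: "z \<notin> \<Lambda>"
  shows "f z = l"
proof -
  define g where "g = (\<lambda>z. if z \<in> \<Lambda> then l else f z)"
  have gper: "g (z + w) = g z" if w: "w \<in> \<Lambda>" for z w
    using periodic_generators[of f z w, OF per _ w] Lambda_add_iff[OF w, of z] by (simp add: g_def)
  obtain e where e: "e > 0" "ball 0 e - {0} \<subseteq> - \<Lambda>"
    by (rule punctured_ball_avoids_Lambda)
  have gf: "g holomorphic_on - \<Lambda>"
    by (rule holomorphic_transform[OF hol]) (simp add: g_def)
  have "(g \<longlongrightarrow> l) (at 0)"
    by (rule Lim_transform_within[OF lim e(1)]) (use e in \<open>auto simp: g_def dist_norm\<close>)
  then have "(g \<longlongrightarrow> g 0) (at 0)" using zero_in_Lambda by (simp add: g_def)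
  have "g holomorphic_on ball 0 e"
  proof (rule no_isolated_singularity'[of "{0}"])
    show "(g \<longlongrightarrow> g z) (at z within ball 0 e)" if "z \<in> {0}" for z
      using that \<open>(g \<longlongrightarrow> g 0) (at 0)\<close> by (auto intro: tendsto_within_subset)
  qed (auto intro: holomorphic_on_subset[OF gf e(2)])
  then have diff0: "g field_differentiable at 0"
    using e(1) by (simp add: holomorphic_on_imp_differentiable_at)
  have "g field_differentiable at z" for z
  proof (cases "z \<in> \<Lambda>")
    case True
    then have "- z \<in> \<Lambda>" by (rule Lambda_uminus)
    have "(g has_field_derivative deriv g 0) (at (z + - z))"
      using diff0 by (simp add: DERIV_deriv_iff_field_differentiable)
    then have "((\<lambda>x. g (x + - z)) has_field_derivative deriv g 0) (at z)"
      by (subst (asm) DERIV_shift)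
    then have "(g has_field_derivative deriv g 0) (at z)"
      using gper[OF \<open>- z \<in> \<Lambda>\<close>] by simp
    then show ?thesis by (auto simp: field_differentiable_def)
  next
    case False
    then show ?thesis
      using gf open_compl_lattice[of UNIV] by (intro holomorphic_on_imp_differentiable_at) auto
  qed
  then have ent: "g holomorphic_on UNIV" by (simp add: holomorphic_on_def)
  have "range g \<subseteq> g ` ((\<lambda>(x,y). of_real x * w1 + of_real y * w2) ` ({0..1} \<times> {0..1}))"
  proof safe
    fix z
    obtain x y where z: "z = of_real x * w1 + of_real y * w2" using lincomb_ex by blast
    have "g z = g (z + \<omega> (- \<lfloor>x\<rfloor>, - \<lfloor>y\<rfloor>))" by (rule gper[symmetric]) auto
    also have "z + \<omega> (- \<lfloor>x\<rfloor>, - \<lfloor>y\<rfloor>) = of_real (frac x) * w1 + of_real (frac y) * w2"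
      by (simp add: z lattice_pt_def frac_def algebra_simps)
    finally have "g z = g ((\<lambda>(x,y). of_real x * w1 + of_real y * w2) (frac x, frac y))" by simp
    moreover have "(frac x, frac y) \<in> {0..1} \<times> {0..1}" by (simp add: frac_lt_1 less_imp_le)
    ultimately show "g z \<in> g ` ((\<lambda>(x,y). of_real x * w1 + of_real y * w2) ` ({0..1} \<times> {0..1}))"
      by blast
  qed
  moreover have "compact (g ` ((\<lambda>(x,y). of_real x * w1 + of_real y * w2) ` ({0..1::real} \<times> {0..1::real})))"
    using ent by (intro compact_continuous_image compact_Times)
      (auto simp: case_prod_unfold intro!: continuous_intros intro: holomorphic_on_imp_continuous_on holomorphic_on_subset)
  ultimately have "bounded (range g)" by (meson bounded_subset compact_imp_bounded)
  with ent have "g constant_on UNIV" by (rule Liouville_theorem)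
  then have "g z = g 0" by (auto simp: constant_on_def)
  then show ?thesis using z zero_in_Lambda by (simp add: g_def)
qed

lemma wp_at_0: "((\<lambda>z. z\<^sup>2 * wp z) \<longlongrightarrow> 1) (at 0)"
proof -
  obtain e where e: "e > 0" "ball 0 e \<subseteq> - \<Lambda>0"
    by (rule punctured_ball_avoids_Lambda)
  have "continuous_on (ball 0 e) wp_rem"
    by (rule continuous_on_subset[OF holomorphic_on_imp_continuous_on[OF holomorphic_wp_rem] e(2)])
  then have "isCont wp_rem 0" using e by (simp add: continuous_on_eq_continuous_at)
  then have "((\<lambda>z. 1 + 3 * G 4 * z ^ 4 + 5 * G 6 * z ^ 6 + z ^ 7 * wp_rem z) \<longlongrightarrow> 1 + 3 * G 4 * 0 ^ 4 + 5 * G 6 * 0 ^ 6 + 0 ^ 7 * wp_rem 0) (at 0)"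
    by (intro tendsto_intros) (simp add: isCont_def)
  then have "((\<lambda>z. 1 + 3 * G 4 * z ^ 4 + 5 * G 6 * z ^ 6 + z ^ 7 * wp_rem z) \<longlongrightarrow> 1) (at 0)" by simp
  then show ?thesis
  proof (rule Lim_transform_within[OF _ e(1)])
    fix z :: complex assume "0 < dist z 0" "dist z 0 < e"
    then have z: "z \<noteq> 0" "z \<notin> \<Lambda>0" using e by (auto simp: subset_iff)
    have "z ^ 4 = z\<^sup>2 * z\<^sup>2" "z ^ 6 = z\<^sup>2 * z ^ 4" "z ^ 7 = z\<^sup>2 * z ^ 5" by (simp_all flip: power_add)
    then show "1 + 3 * G 4 * z ^ 4 + 5 * G 6 * z ^ 6 + z ^ 7 * wp_rem z = z\<^sup>2 * wp z"
      using z by (simp add: wp_expansion distrib_left mult_ac)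
  qed
qed

lemma eventually_wp_neq: "eventually (\<lambda>z. wp z \<noteq> c) (at 0)"
proof -
  have "((\<lambda>z. z\<^sup>2 * wp z - z\<^sup>2 * c) \<longlongrightarrow> 1 - 0\<^sup>2 * c) (at 0)"
    by (intro tendsto_intros wp_at_0)
  then have "eventually (\<lambda>z. z\<^sup>2 * wp z - z\<^sup>2 * c \<noteq> 0) (at 0)"
    by (rule tendsto_imp_eventually_ne) simp
  then show ?thesis by eventually_elim auto
qed

lemma wp_has_deriv: "z \<notin> \<Lambda> \<Longrightarrow> (wp has_field_derivative deriv wp z) (at z)"
  using holomorphic_wp open_compl_lattice[of UNIV] by (simp add: holomorphic_derivI)

lemma deriv_wp_periodic:
  assumes z: "z \<notin> \<Lambda>" and w: "w \<in> \<Lambda>"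
  shows "deriv wp (z + w) = deriv wp z"
proof -
  have "z + w \<notin> \<Lambda>" using assms Lambda_add_iff by blast
  from wp_has_deriv[OF this] have "((\<lambda>x. wp (x + w)) has_field_derivative deriv wp (z + w)) (at z)"
    by (simp add: DERIV_shift)
  then have "(wp has_field_derivative deriv wp (z + w)) (at z)"
    by (rule has_field_derivative_transform_within_open[OF _ open_compl_lattice[of UNIV]])
       (use z w wp_periodic in auto)
  then show ?thesis by (simp add: DERIV_imp_deriv)
qed

lemma deriv_wp_minus:
  assumes z: "z \<notin> \<Lambda>"
  shows "deriv wp (- z) = - deriv wp z"
proof -
  have "- z \<notin> \<Lambda>" using z Lambda_uminus_iff by simp
  then have "((\<lambda>z. wp (- z)) has_field_derivative deriv wp (- z) * - 1) (at z)"
    by (intro DERIV_chain2[of wp _ uminus z, OF wp_has_deriv]) (auto intro!: derivative_eq_intros)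
  then have "(wp has_field_derivative - deriv wp (- z)) (at z)" by (simp add: wp_minus)
  then have "deriv wp z = - deriv wp (- z)" by (simp add: DERIV_imp_deriv)
  then show ?thesis by simp
qed

text \<open>The points \<open>h\<close> and \<open>- h\<close> are congruent modulo the lattice,
  while the derivative is odd.\<close>

lemma deriv_wp_half_period:
  assumes "h \<notin> \<Lambda>" "2 * h \<in> \<Lambda>"
  shows "deriv wp h = 0"
proof -
  have "- h \<notin> \<Lambda>" using assms Lambda_uminus_iff by simp
  from deriv_wp_periodic[OF this assms(2)] have "deriv wp h = - deriv wp h"
    using deriv_wp_minus[OF assms(1)] by simp
  then show ?thesis by simp
qed

text \<open>The two invariants are exactly the coefficients that cancel the terms of order
  \<open>z^-2\<close> and \<open>z^0\<close> in the defect \<open>D\<close>. Hence \<open>D\<close>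
  is elliptic with limit \<open>0\<close> at the origin, and is constant.\<close>

lemma wp_ode:
  assumes "z \<notin> \<Lambda>"
  shows "(deriv wp z)\<^sup>2 = 4 * wp z ^ 3 - g2_lattice w1 w2 * wp z - g3_lattice w1 w2"
proof -
  define a b where "a = 3 * G 4" and "b = 5 * G 6"
  have g: "g2_lattice w1 w2 = 20 * a" "g3_lattice w1 w2 = 28 * b"
    by (simp_all add: g2_lattice_def g3_lattice_def a_def b_def G_def)
  define D where "D = (\<lambda>z. (deriv wp z)\<^sup>2 - (4 * wp z ^ 3 - 20 * a * wp z - 28 * b))"
  \<comment> \<open>\<open>\<wp> = 1/z\<^sup>2 + z\<^sup>2 k\<close> and \<open>\<wp>' = -2/z\<^sup>3 + z l\<close>; the defect \<open>D\<close> then equals \<open>E\<close>, which vanishes at \<open>0\<close>.\<close>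
  define k where "k = (\<lambda>z. a + b * z\<^sup>2 + z ^ 3 * wp_rem z)"
  define l where "l = (\<lambda>z. 2 * a + 4 * b * z\<^sup>2 + 5 * z ^ 3 * wp_rem z + z ^ 4 * deriv wp_rem z)"
  define E where "E = (\<lambda>z. - 32 * z * wp_rem z - 4 * z\<^sup>2 * deriv wp_rem z
                        + z\<^sup>2 * ((l z)\<^sup>2 - 12 * (k z)\<^sup>2 - 4 * z ^ 4 * k z ^ 3 + 20 * a * k z))"
  obtain e where e: "e > 0" "ball 0 e - {0} \<subseteq> - \<Lambda>" "ball 0 e \<subseteq> - \<Lambda>0"
    by (rule punctured_ball_avoids_Lambda)
  have DE: "D z = E z" if "z \<in> ball 0 e - {0}" for z
  proof -
    have zn: "z \<noteq> 0" "z \<notin> \<Lambda>" "z \<notin> \<Lambda>0" using that e(2,3) by auto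
    \<comment> \<open>Treating \<open>1/z\<close> as an unknown with the relation
      \<open>i * z = 1\<close> makes the Laurent computation a polynomial identity.\<close>
    define i where "i = 1 / z"
    have iz: "i * z = 1" using zn by (simp add: i_def)
    have i2: "1 / z\<^sup>2 = i\<^sup>2" "2 / z ^ 3 = 2 * i ^ 3" by (simp_all add: i_def power_one_over)
    have "wp z = 1 / z\<^sup>2 + a * z\<^sup>2 + b * z ^ 4 + z ^ 5 * wp_rem z"
      using wp_expansion[OF zn(3)] by (simp add: a_def b_def)
    then have p: "wp z = i\<^sup>2 + z\<^sup>2 * k z"
      unfolding i2 k_def by (simp add: algebra_simps eval_nat_numeral)
    have "(wp_rem has_field_derivative deriv wp_rem z) (at z)"
      using holomorphic_wp_rem open_compl_lattice zn(3) by (simp add: holomorphic_derivI)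
    then have "((\<lambda>z. a * z\<^sup>2 + b * z ^ 4 + z ^ 5 * wp_rem z) has_field_derivative
       (2 * a * z + 4 * b * z ^ 3 + (5 * z ^ 4 * wp_rem z + z ^ 5 * deriv wp_rem z))) (at z)"
      by (auto intro!: derivative_eq_intros simp: eval_nat_numeral algebra_simps)
    moreover have "((\<lambda>z. 1 / z\<^sup>2) has_field_derivative - (2 / z ^ 3)) (at z)"
      using zn(1) by (auto intro!: derivative_eq_intros simp: eval_nat_numeral divide_simps)
    ultimately have "((\<lambda>z. 1 / z\<^sup>2 + (a * z\<^sup>2 + b * z ^ 4 + z ^ 5 * wp_rem z)) has_field_derivative
       (- (2 / z ^ 3) + (2 * a * z + 4 * b * z ^ 3 + (5 * z ^ 4 * wp_rem z + z ^ 5 * deriv wp_rem z)))) (at z)"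
      by (rule DERIV_add[rotated])
    then have "(wp has_field_derivative
       (- (2 / z ^ 3) + (2 * a * z + 4 * b * z ^ 3 + (5 * z ^ 4 * wp_rem z + z ^ 5 * deriv wp_rem z)))) (at z)"
    proof (rule has_field_derivative_transform_within_open[OF _ open_compl_lattice[of UNIV]])
      fix x assume "x \<in> - \<Lambda>"
      then have "x \<notin> \<Lambda>0" by blast
      then show "1 / x\<^sup>2 + (a * x\<^sup>2 + b * x ^ 4 + x ^ 5 * wp_rem x) = wp x"
        by (simp add: wp_expansion a_def b_def add.assoc)
    qed (use zn(2) in simp)
    then have "deriv wp z = - (2 / z ^ 3) + (2 * a * z + 4 * b * z ^ 3 + (5 * z ^ 4 * wp_rem z + z ^ 5 * deriv wp_rem z))"
      by (rule DERIV_imp_deriv)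
    then have p': "deriv wp z = - 2 * i ^ 3 + z * l z"
      unfolding i2 l_def by (simp add: algebra_simps eval_nat_numeral)
    have cancel: "i ^ 2 * z ^ 2 = 1" using iz by algebra
    have "D z = (- 2 * i ^ 3 + z * l z)\<^sup>2 - (4 * (i\<^sup>2 + z\<^sup>2 * k z) ^ 3 - 20 * a * (i\<^sup>2 + z\<^sup>2 * k z) - 28 * b)"
      by (simp add: D_def p p')
    also have "\<dots> = i\<^sup>2 * (20 * a - 4 * l z - 12 * k z) + 28 * b + z\<^sup>2 * ((l z)\<^sup>2 - 12 * (k z)\<^sup>2 - 4 * z ^ 4 * k z ^ 3 + 20 * a * k z)"
      using iz by algebra
    also have "20 * a - 4 * l z - 12 * k z = z\<^sup>2 * (- 28 * b - 32 * z * wp_rem z - 4 * z\<^sup>2 * deriv wp_rem z)"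
      unfolding l_def k_def by algebra
    also have "i\<^sup>2 * (z\<^sup>2 * (- 28 * b - 32 * z * wp_rem z - 4 * z\<^sup>2 * deriv wp_rem z)) = - 28 * b - 32 * z * wp_rem z - 4 * z\<^sup>2 * deriv wp_rem z"
      using cancel by (simp flip: mult.assoc)
    finally show ?thesis by (simp add: E_def)
  qed
  have "continuous_on (ball 0 e) wp_rem"
    by (rule continuous_on_subset[OF holomorphic_on_imp_continuous_on[OF holomorphic_wp_rem] e(3)])
  moreover have "continuous_on (ball 0 e) (deriv wp_rem)"
    by (rule continuous_on_subset[OF holomorphic_on_imp_continuous_on[OF
          holomorphic_deriv[OF holomorphic_wp_rem open_compl_lattice]] e(3)])
  ultimately have cont: "isCont wp_rem 0" "isCont (deriv wp_rem) 0"
    using e by (simp_all add: continuous_on_eq_continuous_at)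
  have "isCont E 0" unfolding E_def k_def l_def by (intro continuous_intros cont)
  then have "(E \<longlongrightarrow> 0) (at 0)" by (simp add: isCont_def E_def)
  then have lim: "(D \<longlongrightarrow> 0) (at 0)"
    by (rule Lim_transform_within[OF _ e(1)]) (use DE in \<open>auto simp: dist_norm\<close>)
  have "D z = 0"
  proof (rule elliptic_constant[OF _ _ _ lim assms])
    show "D holomorphic_on - \<Lambda>" unfolding D_def
      by (intro holomorphic_intros holomorphic_wp holomorphic_deriv open_compl_lattice)
    show "D (z + w1) = D z" "D (z + w2) = D z" if "z \<notin> \<Lambda>" for z
      using that by (simp_all add: D_def wp_periodic deriv_wp_periodic w_in_Lambda)
  qed
  then show ?thesis by (simp add: D_def g)
qed

lemma wp_half_period_root:
  assumes "h \<notin> \<Lambda>" "2 * h \<in> \<Lambda>"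
  shows "4 * wp h ^ 3 - g2_lattice w1 w2 * wp h - g3_lattice w1 w2 = 0"
  using wp_ode[OF assms(1)] deriv_wp_half_period[OF assms] by simp

text \<open>For \<open>e = \<wp>(w1/2)\<close> the product \<open>(\<wp>(z) - e)(\<wp>(z + w1/2) - e)\<close> is elliptic for the
  finer lattice generated by \<open>w1/2\<close> and \<open>w2\<close>, and the double zero of each factor cancels the
  pole of the other; so it is a constant, which cannot be \<open>0\<close>.\<close>
lemma wp_neq_wp_half_w1:
  assumes z: "z \<notin> range (lattice_pt (w1 / 2) w2)"
  shows "wp z \<noteq> wp (w1 / 2)"
proof
  assume eq: "wp z = wp (w1 / 2)"
  interpret H: complex_lattice "w1 / 2" w2
  proof
    have "w2 / (w1 / 2) = w2 / w1 + w2 / w1" by simp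
    then show "Im (w2 / (w1 / 2)) \<noteq> 0" using Im_ratio by (simp only: plus_complex.simps)
  qed
  define h e where "h = w1 / 2" and "e = wp h"
  have "lattice_pt w1 w2 mn = lattice_pt h w2 (2 * fst mn, snd mn)" for mn
    by (simp add: lattice_pt_def h_def)
  then have sub: "\<Lambda> \<subseteq> H.\<Lambda>" by (auto simp: h_def)
  have hH: "h \<in> H.\<Lambda>" using H.w_in_Lambda by (simp add: h_def)
  have hn: "h \<notin> \<Lambda>"
  proof
    assume "h \<in> \<Lambda>"
    then obtain m n where "w1 / 2 = of_int m * w1 + of_int n * w2" by (auto simp: h_def lattice_pt_def)
    then have "of_real (of_int m - 1/2) * w1 + of_real (of_int n) * w2 = 0" by (simp add: algebra_simps)
    then have "real_of_int m = 1/2" using lincomb_eq_0(1) by fastforce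
    then have "real_of_int (2 * m) = real_of_int 1" by simp
    then have "2 * m = 1" by (simp only: of_int_eq_iff)
    then show False by presburger
  qed
  have nl: "z \<notin> \<Lambda>" "z + h \<notin> \<Lambda>" if "z \<notin> H.\<Lambda>" for z
    using that sub H.Lambda_add_iff[OF hH] by blast+
  define F where "F = (\<lambda>z. (wp z - e) * (wp (z + h) - e))"
  have holF: "F holomorphic_on - H.\<Lambda>"
    unfolding F_def by (intro holomorphic_intros holomorphic_on_compose_gen[OF _ holomorphic_wp, unfolded o_def]
        holomorphic_on_subset[OF holomorphic_wp]) (use nl in auto)
  have per1: "F (z + w1 / 2) = F z" if "z \<notin> H.\<Lambda>" for z
  proof -
    have "wp (z + h + h) = wp z" using wp_add_w1[OF nl(1)[OF that]] by (simp add: h_def add.assoc)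
    then show ?thesis by (simp add: F_def flip: h_def)
  qed
  have per2: "F (z + w2) = F z" if "z \<notin> H.\<Lambda>" for z
    using wp_add_w2[OF nl(1)[OF that]] wp_add_w2[OF nl(2)[OF that]] by (simp add: F_def add_ac)
  have "h \<in> - \<Lambda>" using hn by simp
  then obtain r where r: "r > 0" "ball h r \<subseteq> - \<Lambda>"
    by (rule openE[OF open_compl_lattice])
  define g where "g = (\<lambda>z. wp (z + h) - e)"
  have zh: "z + h \<notin> \<Lambda>" if "z \<in> ball 0 r" for z
  proof -
    have "z + h \<in> ball h r" using that by (simp add: dist_norm)
    then show ?thesis using r by auto
  qed
  have im: "(\<lambda>z. z + h) ` ball 0 r \<subseteq> - \<Lambda>"
    by (rule image_subsetI, rule ComplI, rule notE[OF zh])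
  have "g holomorphic_on ball 0 r"
    unfolding g_def
    by (intro holomorphic_intros holomorphic_on_compose_gen[OF _ holomorphic_wp, unfolded o_def] im)
  \<comment> \<open>The reflection of \<open>h + z\<close> in \<open>h\<close> is
    \<open>h - z\<close>, and \<open>wp (h - z) = wp (z - h) = wp (z + h)\<close> because
    \<open>2 h = w1\<close> is a period.\<close>
  moreover have "g (- z) = g z" if "z \<in> ball 0 r" for z
  proof -
    have "wp (- z + h) = wp (z - h)" using wp_minus[of "z - h"] by (simp add: algebra_simps)
    moreover have "z - h \<notin> \<Lambda>"
      using zh[OF that] Lambda_diff_iff[OF w_in_Lambda(1), of "z + h"] by (simp add: h_def algebra_simps)
    ultimately show ?thesis using wp_add_w1[of "z - h"] by (simp add: g_def h_def add.commute)
  qed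
  moreover have "g 0 = 0" by (simp add: g_def e_def)
  ultimately obtain c where "((\<lambda>z. g z / z\<^sup>2) \<longlongrightarrow> c) (at 0)"
    using even_double_zero_quotient[of g r] r(1) by blast
  then have "((\<lambda>z. (z\<^sup>2 * wp z - z\<^sup>2 * e) * (g z / z\<^sup>2)) \<longlongrightarrow> (1 - 0\<^sup>2 * e) * c) (at 0)"
    by (intro tendsto_intros wp_at_0)
  then have "((\<lambda>z. (z\<^sup>2 * wp z - z\<^sup>2 * e) * (g z / z\<^sup>2)) \<longlongrightarrow> c) (at 0)" by simp
  then have lim: "(F \<longlongrightarrow> c) (at 0)"
    by (rule Lim_transform_within[OF _ zero_less_one])
       (simp add: F_def g_def field_simps)
  have Fc: "F z = c" if "z \<notin> H.\<Lambda>" for z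
    by (rule H.elliptic_constant[OF holF per1 per2 lim that])
  \<comment> \<open>The supposed coincidence makes the constant vanish. Near the pole at
    \<open>0\<close> the factor \<open>wp z - e\<close> is nonzero, so the other factor vanishes
    there; the identity theorem then makes \<open>wp\<close> constant, contradicting the
    pole.\<close>
  have "c = 0" using Fc[OF z] eq by (simp add: F_def e_def h_def)
  have "eventually (\<lambda>z. z \<notin> H.\<Lambda>) (at 0)"
  proof -
    obtain s where s: "s > 0" "ball 0 s - {0} \<subseteq> - H.\<Lambda>"
      by (rule H.punctured_ball_avoids_Lambda)
    then show ?thesis unfolding eventually_at by (intro exI[of _ s]) (auto simp: dist_norm)
  qed
  then have "eventually (\<lambda>z. wp (z + h) = e) (at 0)"
    using eventually_wp_neq[of e] by eventually_elim (use Fc \<open>c = 0\<close> in \<open>auto simp: F_def\<close>)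
  then obtain d where d: "d > 0" "\<And>z. z \<noteq> 0 \<Longrightarrow> dist z 0 < d \<Longrightarrow> wp (z + h) = e"
    by (auto simp: eventually_at)
  define U where "U = ball h (min d r)"
  have U: "wp z = e" if "z \<in> U" for z
    using d(2)[of "z - h"] that by (cases "z = h") (auto simp: U_def e_def dist_norm norm_minus_commute)
  have "wp z - e = 0" if "z \<in> - \<Lambda>" for z
  proof (rule analytic_continuation[of "\<lambda>z. wp z - e" "- \<Lambda>" U h])
    show "h islimpt U" using d r by (simp add: U_def islimpt_ball)
  qed (use that hn U r holomorphic_wp open_compl_lattice[of UNIV] connected_compl_Lambda
        in \<open>auto simp: U_def intro!: holomorphic_intros\<close>)
  moreover have "eventually (\<lambda>z. z \<notin> H.\<Lambda> \<and> wp z \<noteq> e) (at 0)"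
    using \<open>eventually (\<lambda>z. z \<notin> H.\<Lambda>) (at 0)\<close> eventually_wp_neq[of e] by eventually_elim auto
  then obtain z where z: "z \<notin> H.\<Lambda>" "wp z \<noteq> e"
    using eventually_happens[of "\<lambda>z. z \<notin> H.\<Lambda> \<and> wp z \<noteq> e" "at 0"] by auto
  ultimately show False using nl(1)[OF z(1)] by simp
qed

end

section \<open>The reciprocal of a shifted Weierstrass function\<close>

context complex_lattice
begin

text \<open>Multiplying \<open>wp + 1/3\<close> by \<open>z^2\<close> gives \<open>E\<close> with
  \<open>E 0 = 1\<close>, so \<open>Q = (K/2) z^2 / E\<close> is holomorphic with a double zero at
  \<open>0\<close>. The equation for \<open>wp\<close> yields
  \<open>Q'^2 = 2 K Q - 4 Q^2 + 2 Q^3\<close>; differentiating and dividing by \<open>2 Q'\<close>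
  gives the second-order equation.\<close>

lemma wp_reciprocal_ode:
  fixes K :: complex
  assumes K: "K \<noteq> 0" and g: "g2_lattice w1 w2 = 4/3 - K" "g3_lattice w1 w2 = 8/27 - K / 3"
  obtains r Q where "r > 0" "Q holomorphic_on ball 0 r" "Q 0 = 0" "deriv Q 0 = 0"
    "\<forall>z\<in>ball 0 r - {0}. Q z = (K / 2) / (wp z + 1/3)"
    "\<forall>z\<in>ball 0 r. deriv (deriv Q) z = K - 4 * Q z + 3 * (Q z)\<^sup>2"
proof -
  obtain e where e: "e > 0" "ball 0 e - {0} \<subseteq> - \<Lambda>" "ball 0 e \<subseteq> - \<Lambda>0"
    by (rule punctured_ball_avoids_Lambda)
  define E where "E = (\<lambda>z. 1 + z\<^sup>2 / 3 + 3 * G 4 * z ^ 4 + 5 * G 6 * z ^ 6 + z ^ 7 * wp_rem z)"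
  define Q where "Q = (\<lambda>z. K / 2 * z\<^sup>2 / E z)"
  have holE: "E holomorphic_on ball 0 e"
    unfolding E_def by (intro holomorphic_intros holomorphic_on_subset[OF holomorphic_wp_rem e(3)]) auto
  then have "continuous_on (ball 0 e) E" by (rule holomorphic_on_imp_continuous_on)
  then have "isCont E 0" using e by (simp add: continuous_on_eq_continuous_at)
  then have "eventually (\<lambda>z. E z \<noteq> 0) (at 0)"
    unfolding isCont_def by (rule tendsto_imp_eventually_ne) (simp add: E_def)
  then obtain r1 where r1: "r1 > 0" "\<And>z. z \<noteq> 0 \<Longrightarrow> dist z 0 < r1 \<Longrightarrow> E z \<noteq> 0"
    by (auto simp: eventually_at)
  define r2 where "r2 = min e r1"
  have r2: "r2 > 0" using e r1 by (simp add: r2_def)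
  have E0: "E 0 = 1" by (simp add: E_def)
  have Enz: "E z \<noteq> 0" if "z \<in> ball 0 r2" for z
    using r1(2)[of z] E0 that by (cases "z = 0") (auto simp: r2_def)
  have subr2: "ball 0 r2 \<subseteq> ball (0::complex) e" by (auto simp: r2_def)
  have holQ2: "Q holomorphic_on ball 0 r2"
    unfolding Q_def by (intro holomorphic_intros holomorphic_on_subset[OF holE subr2] Enz)
  have "continuous_on (ball 0 r2) Q" by (rule holomorphic_on_imp_continuous_on[OF holQ2])
  then have "isCont Q 0" using r2 by (simp add: continuous_on_eq_continuous_at)
  \<comment> \<open>This is the cofactor of \<open>Q\<close> in \<open>Q'^2\<close>. Its value
    \<open>2 K\<close> at the origin is nonzero, so on a small punctured disc \<open>Q'\<close> has
    no zero and may be cancelled.\<close>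
  then have "((\<lambda>z. 2 * K - 4 * Q z + 2 * (Q z)\<^sup>2) \<longlongrightarrow> 2 * K - 4 * Q 0 + 2 * (Q 0)\<^sup>2) (at 0)"
    unfolding isCont_def by (intro tendsto_intros)
  then have "eventually (\<lambda>z. 2 * K - 4 * Q z + 2 * (Q z)\<^sup>2 \<noteq> 0) (at 0)"
    by (rule tendsto_imp_eventually_ne) (use K in \<open>simp add: Q_def\<close>)
  then obtain r3 where r3: "r3 > 0" "\<And>z. z \<noteq> 0 \<Longrightarrow> dist z 0 < r3 \<Longrightarrow> 2 * K - 4 * Q z + 2 * (Q z)\<^sup>2 \<noteq> 0"
    by (auto simp: eventually_at)
  define r where "r = min r2 r3"
  have r: "r > 0" using r2 r3 by (simp add: r_def)
  have subr: "ball 0 r \<subseteq> ball (0::complex) r2" by (auto simp: r_def)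
  have holQ: "Q holomorphic_on ball 0 r" by (rule holomorphic_on_subset[OF holQ2 subr])
  have Q0: "Q 0 = 0" by (simp add: Q_def)
  have dQ0: "deriv Q 0 = 0"
  proof -
    define s where "s = (\<lambda>z. K / 2 / E z)"
    have "s holomorphic_on ball 0 r2"
      unfolding s_def by (intro holomorphic_intros holomorphic_on_subset[OF holE subr2] Enz)
    then have "(s has_field_derivative deriv s 0) (at 0)" using r2 by (simp add: holomorphic_derivI)
    then have "((\<lambda>z. z\<^sup>2 * s z) has_field_derivative 0) (at 0)"
      by (auto intro!: derivative_eq_intros)
    moreover have "(\<lambda>z. z\<^sup>2 * s z) = Q" by (simp add: Q_def s_def fun_eq_iff)
    ultimately show ?thesis by (simp add: DERIV_imp_deriv)
  qed
  have nL: "z \<notin> \<Lambda>" and P: "wp z + 1/3 = E z / z\<^sup>2" and Qwp: "Q z = (K / 2) / (wp z + 1/3)" and Pnz: "wp z + 1/3 \<noteq> 0"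
    if z: "z \<in> ball 0 r - {0}" for z
  proof -
    have ze: "z \<in> ball 0 e - {0}" using z subr subr2 by blast
    then show "z \<notin> \<Lambda>" using e(2) by blast
    have z0: "z \<noteq> 0" "z \<notin> \<Lambda>0" using ze e(3) by blast+
    have "z ^ 4 = z\<^sup>2 * z\<^sup>2" "z ^ 6 = z\<^sup>2 * z ^ 4" "z ^ 7 = z\<^sup>2 * z ^ 5" by (simp_all flip: power_add)
    then have "E z = z\<^sup>2 * (wp z + 1/3)"
      using z0 by (simp add: E_def wp_expansion distrib_left mult_ac)
    then show P: "wp z + 1/3 = E z / z\<^sup>2" using z0 by simp
    moreover have "E z \<noteq> 0" using Enz z subr by blast
    ultimately show "wp z + 1/3 \<noteq> 0" "Q z = (K / 2) / (wp z + 1/3)" using z0 by (simp_all add: Q_def)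
  qed
  have opn: "open (ball 0 r - {0::complex})" by auto
  have dQ: "(Q has_field_derivative deriv Q z) (at z)" if "z \<in> ball 0 r" for z
    using holQ that by (simp add: holomorphic_derivI)
  have ddQ: "(deriv Q has_field_derivative deriv (deriv Q) z) (at z)" if "z \<in> ball 0 r" for z
    using holomorphic_deriv[OF holQ open_ball] that by (simp add: holomorphic_derivI)
  have first: "(deriv Q z)\<^sup>2 = 2 * K * Q z - 4 * (Q z)\<^sup>2 + 2 * Q z ^ 3" if z: "z \<in> ball 0 r - {0}" for z
  proof -
    have "((\<lambda>z. c / (wp z + 1/3)) has_field_derivative - c * deriv wp z / (wp z + 1/3)\<^sup>2) (at z)" for c
      using Pnz[OF z] by (auto intro!: derivative_eq_intros wp_has_deriv nL[OF z] simp: power2_eq_square)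
    from this[of "K / 2"] have "(Q has_field_derivative - (K / 2) * deriv wp z / (wp z + 1/3)\<^sup>2) (at z)"
      by (rule has_field_derivative_transform_within_open[OF _ opn z]) (simp add: Qwp)
    then have dq: "deriv Q z = - (K / 2) * deriv wp z / (wp z + 1/3)\<^sup>2" by (rule DERIV_imp_deriv)
    define i where "i = 1 / (wp z + 1/3)"
    have i: "i * (wp z + 1/3) = 1" using Pnz[OF z] by (simp add: i_def)
    have Qi: "Q z = K / 2 * i" using Qwp[OF z] by (simp add: i_def)
    have "- (K / 2) * d / P\<^sup>2 = - (K / 2) * d * (1 / P)\<^sup>2" for d P by (simp add: power_one_over)
    from dq[unfolded this] have "deriv Q z = - (K / 2) * deriv wp z * i\<^sup>2" by (simp only: i_def)
    then have "(deriv Q z)\<^sup>2 = (K / 2)\<^sup>2 * ((deriv wp z)\<^sup>2 * i ^ 4)"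
      by (simp add: power_mult_distrib power_divide)
    also have "(deriv wp z)\<^sup>2 = 4 * wp z ^ 3 - (4/3 - K) * wp z - (8/27 - K / 3)"
      using wp_ode[OF nL[OF z]] by (simp add: g)
    \<comment> \<open>As \<open>-1/3\<close> is a root of the cubic, no constant term appears in
      powers of \<open>wp z + 1/3\<close>. Multiplication by \<open>i ^ 4\<close> therefore gives a
      polynomial of degree 3 in \<open>i\<close>, hence in \<open>Q z\<close>.\<close>
    also have "\<dots> = 4 * (wp z + 1/3) ^ 3 - 4 * (wp z + 1/3)\<^sup>2 + K * (wp z + 1/3)"
      by (simp add: power3_eq_cube power2_eq_square algebra_simps)
    also have "\<dots> * i ^ 4 = 4 * i - 4 * i\<^sup>2 + K * i ^ 3"
    proof -
      have "(4 * P ^ 3 - 4 * P\<^sup>2 + K * P) * i ^ 4 = 4 * i - 4 * i\<^sup>2 + K * i ^ 3" if "i * P = 1" for P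
        using that by algebra
      from this[OF i] show ?thesis .
    qed
    finally show ?thesis
      unfolding Qi by (simp add: power2_eq_square power3_eq_cube algebra_simps)
  qed
  have second: "deriv (deriv Q) z = K - 4 * Q z + 3 * (Q z)\<^sup>2" if z: "z \<in> ball 0 r - {0}" for z
  proof -
    have zb: "z \<in> ball 0 r" using z by blast
    have "((\<lambda>z. (deriv Q z)\<^sup>2) has_field_derivative 2 * deriv Q z * deriv (deriv Q) z) (at z)"
      by (rule derivative_eq_intros ddQ[OF zb] refl | simp)+
    then have "((\<lambda>z. 2 * K * Q z - 4 * (Q z)\<^sup>2 + 2 * Q z ^ 3) has_field_derivative 2 * deriv Q z * deriv (deriv Q) z) (at z)"
      by (rule has_field_derivative_transform_within_open[OF _ opn z]) (simp add: first)
    moreover have "((\<lambda>z. 2 * K * Q z - 4 * (Q z)\<^sup>2 + 2 * Q z ^ 3) has_field_derivative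
        2 * K * deriv Q z - 8 * Q z * deriv Q z + 6 * (Q z)\<^sup>2 * deriv Q z) (at z)"
      by (rule derivative_eq_intros dQ[OF zb] refl | simp)+
    ultimately have "2 * deriv Q z * deriv (deriv Q) z = 2 * K * deriv Q z - 8 * Q z * deriv Q z + 6 * (Q z)\<^sup>2 * deriv Q z"
      by (rule DERIV_unique)
    then have "2 * deriv Q z * (deriv (deriv Q) z - (K - 4 * Q z + 3 * (Q z)\<^sup>2)) = 0" by algebra
    moreover have "deriv Q z \<noteq> 0"
    proof
      assume "deriv Q z = 0"
      then have "Q z * (2 * K - 4 * Q z + 2 * (Q z)\<^sup>2) = 0" using first[OF z] by algebra
      moreover have "Q z \<noteq> 0" unfolding Qwp[OF z] divide_eq_0_iff using K Pnz[OF z] by simp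
      ultimately show False using r3(2)[of z] z by (auto simp: r_def)
    qed
    ultimately show ?thesis by simp
  qed
  \<comment> \<open>At the origin \<open>deriv Q\<close> vanishes and cannot be cancelled; the
    equation extends there by continuity.\<close>
  have "deriv (deriv Q) 0 = K - 4 * Q 0 + 3 * (Q 0)\<^sup>2"
  proof (rule tendsto_unique)
    have "continuous_on (ball 0 r) (deriv (deriv Q))"
      by (intro holomorphic_on_imp_continuous_on holomorphic_deriv holQ open_ball)
    then show "(deriv (deriv Q) \<longlongrightarrow> deriv (deriv Q) 0) (at 0)"
      using r by (simp add: continuous_on_eq_continuous_at isCont_def)
    have "((\<lambda>z. K - 4 * Q z + 3 * (Q z)\<^sup>2) \<longlongrightarrow> K - 4 * Q 0 + 3 * (Q 0)\<^sup>2) (at 0)"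
      using \<open>isCont Q 0\<close> unfolding isCont_def by (intro tendsto_intros)
    then show "(deriv (deriv Q) \<longlongrightarrow> K - 4 * Q 0 + 3 * (Q 0)\<^sup>2) (at 0)"
      by (rule Lim_transform_within[OF _ r]) (simp add: second)
  qed auto
  with second have "deriv (deriv Q) z = K - 4 * Q z + 3 * (Q z)\<^sup>2" if "z \<in> ball 0 r" for z
    using that by (cases "z = 0") auto
  with r holQ Q0 dQ0 Qwp show ?thesis by (intro that[of r Q]) auto
qed

end

section \<open>Half-period values and lattices with prescribed invariants\<close>

lemma cnj_wp_lattice: "cnj (wp_lattice w1 w2 z) = wp_lattice (cnj w1) (cnj w2) (cnj z)"
  by (simp add: wp_lattice_def lattice_pt_def flip: infsum_cnj)

lemma wp_lattice_uminus_w2: "wp_lattice w1 (- w2) = wp_lattice w1 w2"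
proof
  fix z
  have "bij_betw (\<lambda>(m::int,n::int). (m,-n)) (UNIV - {(0,0)}) (UNIV - {(0,0)})"
    by (rule bij_betwI[of _ _ _ "\<lambda>(m,n). (m,-n)"]) auto
  from infsum_reindex_bij_betw[OF this, of "\<lambda>mn. 1 / (z - lattice_pt w1 w2 mn)\<^sup>2 - 1 / (lattice_pt w1 w2 mn)\<^sup>2"]
  show "wp_lattice w1 (- w2) z = wp_lattice w1 w2 z"
    by (simp add: wp_lattice_def case_prod_unfold lattice_pt_def)
qed

lemma lattice_pt_scale: "lattice_pt (c * w1) (c * w2) mn = c * lattice_pt w1 w2 mn"
  by (simp add: lattice_pt_def algebra_simps)

lemma wp_lattice_scale: "wp_lattice (c * w1) (c * w2) (c * z) = wp_lattice w1 w2 z / c\<^sup>2"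
proof -
  have "1 / (c * z - c * w)\<^sup>2 - 1 / (c * w)\<^sup>2 = (1 / c\<^sup>2) * (1 / (z - w)\<^sup>2 - 1 / w\<^sup>2)" for w
  proof -
    have "(c * z - c * w)\<^sup>2 = c\<^sup>2 * (z - w)\<^sup>2" by algebra
    then show ?thesis by (simp add: power_mult_distrib right_diff_distrib)
  qed
  then have "wp_lattice (c * w1) (c * w2) (c * z) = 1 / (c * z)\<^sup>2 + (1 / c\<^sup>2) *
      infsum (\<lambda>mn. 1 / (z - lattice_pt w1 w2 mn)\<^sup>2 - 1 / (lattice_pt w1 w2 mn)\<^sup>2) (UNIV - {(0,0)})"
    unfolding wp_lattice_def lattice_pt_scale by (simp only: infsum_cmult_right')
  then show ?thesis
    by (simp add: wp_lattice_def power_mult_distrib add_divide_distrib)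
qed

lemma g2_lattice_scale: "g2_lattice (c * w1) (c * w2) = g2_lattice w1 w2 / c ^ 4"
  using infsum_cmult_right'[of "1 / c ^ 4" "\<lambda>mn. 1 / lattice_pt w1 w2 mn ^ 4" "UNIV - {(0,0)}"]
  by (simp add: g2_lattice_def lattice_pt_scale power_mult_distrib)

lemma g3_lattice_scale: "g3_lattice (c * w1) (c * w2) = g3_lattice w1 w2 / c ^ 6"
  using infsum_cmult_right'[of "1 / c ^ 6" "\<lambda>mn. 1 / lattice_pt w1 w2 mn ^ 6" "UNIV - {(0,0)}"]
  by (simp add: g3_lattice_def lattice_pt_scale power_mult_distrib)

context complex_lattice
begin

lemma lincomb_inject:
  assumes "of_real x * w1 + of_real y * w2 = of_real x' * w1 + of_real y' * w2"
  shows "x = x'" "y = y'"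
proof -
  have "of_real (x - x') * w1 + of_real (y - y') * w2 = 0" using assms by (simp add: algebra_simps)
  from lincomb_eq_0[OF this] show "x = x'" "y = y'" by auto
qed

lemma lincomb_in_Lambda_iff:
  "of_real x * w1 + of_real y * w2 \<in> \<Lambda> \<longleftrightarrow> x \<in> \<int> \<and> y \<in> \<int>"
proof
  assume "of_real x * w1 + of_real y * w2 \<in> \<Lambda>"
  then obtain m n where "of_real x * w1 + of_real y * w2 = of_real (of_int m) * w1 + of_real (of_int n) * w2"
    by (auto simp: lattice_pt_def)
  from lincomb_inject[OF this] show "x \<in> \<int> \<and> y \<in> \<int>" by simp
next
  assume "x \<in> \<int> \<and> y \<in> \<int>"
  then obtain m n where "x = of_int m" "y = of_int n" by (auto elim!: Ints_cases)
  then show "of_real x * w1 + of_real y * w2 \<in> \<Lambda>"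
    by (intro range_eqI[of _ _ "(m,n)"]) (simp add: lattice_pt_def)
qed

lemma half_notin_Ints: "(1/2::real) \<notin> \<int>"
proof
  assume "(1/2::real) \<in> \<int>"
  then obtain k :: int where "1/2 = real_of_int k" by (auto elim: Ints_cases)
  then have "real_of_int (2 * k) = real_of_int 1" by simp
  then have "2 * k = 1" by (simp only: of_int_eq_iff)
  then show False by presburger
qed

lemma half_periods_notin: "w1 / 2 \<notin> \<Lambda>" "w2 / 2 \<notin> \<Lambda>" "(w1 + w2) / 2 \<notin> \<Lambda>"
  using lincomb_in_Lambda_iff[of "1/2" 0] lincomb_in_Lambda_iff[of 0 "1/2"] lincomb_in_Lambda_iff[of "1/2" "1/2"]
  by (simp_all add: half_notin_Ints add_divide_distrib)

text \<open>Both points have second coordinate \<open>1/2\<close> in the basis \<open>w1\<close>,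
  \<open>w2\<close>, so they lie outside the finer lattice generated by \<open>w1/2\<close> and
  \<open>w2\<close>.\<close>

lemma wp_half_w1_neq: "wp (w2 / 2) \<noteq> wp (w1 / 2)" "wp ((w1 + w2) / 2) \<noteq> wp (w1 / 2)"
proof -
  have n: "of_real x * w1 + of_real (1/2) * w2 \<notin> range (lattice_pt (w1 / 2) w2)" for x
  proof
    assume "of_real x * w1 + of_real (1/2) * w2 \<in> range (lattice_pt (w1 / 2) w2)"
    then obtain m n where "of_real x * w1 + of_real (1/2) * w2 = of_real (of_int m / 2) * w1 + of_real (of_int n) * w2"
      by (auto simp: lattice_pt_def)
    from lincomb_inject(2)[OF this] show False using half_notin_Ints by (metis Ints_of_int)
  qed
  show "wp (w2 / 2) \<noteq> wp (w1 / 2)" "wp ((w1 + w2) / 2) \<noteq> wp (w1 / 2)"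
    using wp_neq_wp_half_w1[OF n[of 0]] wp_neq_wp_half_w1[OF n[of "1/2"]] by (simp_all add: add_divide_distrib)
qed

text \<open>The derivative of \<open>wp\<close> vanishes at half periods, so the three values are
  roots of the cubic, and distinct roots give Vieta's relations. The inequality
  \<open>e2 \<noteq> e3\<close> comes from the lattice with exchanged generators.\<close>

lemma half_period_values:
  defines "e1 \<equiv> wp (w1 / 2)" and "e2 \<equiv> wp ((w1 + w2) / 2)" and "e3 \<equiv> wp (w2 / 2)"
  shows "e1 \<noteq> e2" "e1 \<noteq> e3" "e2 \<noteq> e3" "e1 + e2 + e3 = 0"
    "g2_lattice w1 w2 = - 4 * (e1 * e2 + e1 * e3 + e2 * e3)" "g3_lattice w1 w2 = 4 * e1 * e2 * e3"
proof -
  interpret S: complex_lattice w2 w1 by (rule swapped)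
  show ne: "e1 \<noteq> e2" "e1 \<noteq> e3" "e2 \<noteq> e3"
    using wp_half_w1_neq S.wp_half_w1_neq by (auto simp: e1_def e2_def e3_def wp_lattice_swap add.commute)
  have r1: "4 * e1 ^ 3 - g2_lattice w1 w2 * e1 - g3_lattice w1 w2 = 0"
    unfolding e1_def by (rule wp_half_period_root) (use half_periods_notin w_in_Lambda in auto)
  have r2: "4 * e2 ^ 3 - g2_lattice w1 w2 * e2 - g3_lattice w1 w2 = 0"
  proof -
    have "2 * ((w1 + w2) / 2) = w1 + w2" by (simp add: field_simps)
    then have "2 * ((w1 + w2) / 2) \<in> \<Lambda>" by (simp only: Lambda_add w_in_Lambda)
    then show ?thesis unfolding e2_def by (rule wp_half_period_root[OF half_periods_notin(3)])
  qed
  have r3: "4 * e3 ^ 3 - g2_lattice w1 w2 * e3 - g3_lattice w1 w2 = 0"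
    unfolding e3_def by (rule wp_half_period_root) (use half_periods_notin w_in_Lambda in auto)
  have "(e1 - e2) * (4 * (e1\<^sup>2 + e1 * e2 + e2\<^sup>2) - g2_lattice w1 w2) = 0" using r1 r2 by algebra
  then have a: "4 * (e1\<^sup>2 + e1 * e2 + e2\<^sup>2) - g2_lattice w1 w2 = 0" using ne by simp
  have "(e1 - e3) * (4 * (e1\<^sup>2 + e1 * e3 + e3\<^sup>2) - g2_lattice w1 w2) = 0" using r1 r3 by algebra
  then have b: "4 * (e1\<^sup>2 + e1 * e3 + e3\<^sup>2) - g2_lattice w1 w2 = 0" using ne by simp
  have "(e2 - e3) * (e1 + e2 + e3) = 0" using a b by algebra
  then show s: "e1 + e2 + e3 = 0" using ne by simp
  show g2: "g2_lattice w1 w2 = - 4 * (e1 * e2 + e1 * e3 + e2 * e3)" using a s by algebra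
  show "g3_lattice w1 w2 = 4 * e1 * e2 * e3" using r1 g2 s by algebra
qed

end

section \<open>Estimates on rectangular lattices\<close>

text \<open>Factoring out \<open>b - a\<close> gains one power, turning quadratic into summable
  cubic decay. The distance \<open>1/2\<close> is that between the two evaluation points in
  \<open>rect_x\<close> and in \<open>rect_y\<close>.\<close>

lemma norm_inverse_square_diff_le:
  fixes a b :: complex
  assumes \<rho>: "0 < \<rho>" "\<rho> \<le> norm a" "\<rho> \<le> norm b" and d: "norm (a - b) = 1/2"
  shows "norm (1 / a\<^sup>2 - 1 / b\<^sup>2) \<le> 1 / \<rho> ^ 3"
proof -
  have nz: "a \<noteq> 0" "b \<noteq> 0" using \<rho> by auto
  have "1 / a\<^sup>2 - 1 / b\<^sup>2 = (b - a) * (1 / (a\<^sup>2 * b) + 1 / (a * b\<^sup>2))"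
    using nz by (simp add: divide_simps power2_eq_square) (simp add: algebra_simps)
  then have "norm (1 / a\<^sup>2 - 1 / b\<^sup>2) = 1/2 * norm (1 / (a\<^sup>2 * b) + 1 / (a * b\<^sup>2))"
    using d by (simp add: norm_mult norm_minus_commute)
  also have "\<dots> \<le> 1/2 * (1 / \<rho> ^ 3 + 1 / \<rho> ^ 3)"
  proof (intro mult_left_mono order_trans[OF norm_triangle_ineq] add_mono)
    have "\<rho>\<^sup>2 * \<rho> \<le> (norm a)\<^sup>2 * norm b" "\<rho> * \<rho>\<^sup>2 \<le> norm a * (norm b)\<^sup>2"
      using \<rho> by (intro mult_mono power_mono; simp)+
    then have "\<rho> ^ 3 \<le> norm (a\<^sup>2 * b)" "\<rho> ^ 3 \<le> norm (a * b\<^sup>2)"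
      by (simp_all add: norm_mult norm_power power3_eq_cube power2_eq_square mult_ac)
    then show "norm (1 / (a\<^sup>2 * b)) \<le> 1 / \<rho> ^ 3" "norm (1 / (a * b\<^sup>2)) \<le> 1 / \<rho> ^ 3"
      unfolding norm_divide norm_one using \<rho>(1) by (intro frac_le; simp)+
  qed simp
  finally show ?thesis by simp
qed

text \<open>By the arithmetic-geometric mean inequality, \<open>sqrt t * ht mn\<close> is at most
  half of \<open>1 + x + (1 + y) t\<close>. The three summands are at most \<open>4 M\<close>,
  \<open>2 M\<close> and \<open>4 M\<close>, which explains the factor \<open>5\<close>.\<close>

lemma ht_le_decay:
  assumes t: "t \<ge> 1" and m: "\<bar>of_int (fst mn)\<bar> / 2 \<le> M" and n: "(1 + \<bar>of_int (snd mn)\<bar>) * t / 4 \<le> M"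
  shows "sqrt t / 5 * ht mn \<le> M"
proof -
  define x y where "x = \<bar>real_of_int (fst mn)\<bar>" and "y = \<bar>real_of_int (snd mn)\<bar>"
  have xy: "x \<ge> 0" "y \<ge> 0" by (simp_all add: x_def y_def)
  have "1 * 1 \<le> (1 + y) * t" using xy t by (intro mult_mono) auto
  have "sqrt t * ht mn = sqrt ((1 + x) * ((1 + y) * t))"
    by (simp add: ht_def x_def y_def real_sqrt_mult)
  also have "\<dots> \<le> ((1 + x) + (1 + y) * t) / 2"
    by (rule arith_geo_mean_sqrt) (use xy t in auto)
  also have "\<dots> \<le> 5 * M" using m n \<open>1 * 1 \<le> (1 + y) * t\<close> by (simp add: x_def y_def)
  finally show ?thesis by simp
qed

lemma abs_half_minus_int_ge:
  fixes k :: int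
  shows "\<bar>of_int k\<bar> / 2 \<le> \<bar>1/2 - real_of_int k\<bar>" "(1 + \<bar>of_int k\<bar>) / 4 \<le> \<bar>1/2 - real_of_int k\<bar>"
proof -
  have "k \<le> -1 \<or> k = 0 \<or> k \<ge> 1" by linarith
  then show "\<bar>of_int k\<bar> / 2 \<le> \<bar>1/2 - real_of_int k\<bar>" "(1 + \<bar>of_int k\<bar>) / 4 \<le> \<bar>1/2 - real_of_int k\<bar>"
    by (auto simp: abs_if)
qed

lemma norm_rect_ge:
  fixes m n :: int
  assumes "t \<ge> 1" "\<bar>of_int m\<bar> / 2 \<le> \<bar>Re z\<bar>" "(1 + \<bar>of_int n\<bar>) * t / 4 \<le> \<bar>Im z\<bar>"
  shows "sqrt t / 5 * ht (m, n) \<le> norm z"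
  by (rule ht_le_decay) (use assms abs_Re_le_cmod[of z] abs_Im_le_cmod[of z] in auto)

definition rect_pt :: "real \<Rightarrow> int \<times> int \<Rightarrow> complex" where
  "rect_pt t mn = lattice_pt 1 (\<i> * of_real t) mn"

lemma rect_pt_simps [simp]:
  "Re (rect_pt t mn) = of_int (fst mn)" "Im (rect_pt t mn) = of_int (snd mn) * t"
  by (simp_all add: rect_pt_def lattice_pt_def)

text \<open>The series of these terms gives \<open>rect_e1\<close> up to the principal part; that of
  \<open>rect_y\<close> gives \<open>rect_e2 - rect_e3\<close>.\<close>

definition rect_x :: "real \<Rightarrow> int \<times> int \<Rightarrow> complex" where
  "rect_x t mn = 1 / (1/2 - rect_pt t mn)\<^sup>2 - 1 / (rect_pt t mn)\<^sup>2"

definition rect_y :: "real \<Rightarrow> int \<times> int \<Rightarrow> complex" where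
  "rect_y t mn = 1 / ((1 + \<i> * of_real t) / 2 - rect_pt t mn)\<^sup>2 - 1 / (\<i> * of_real t / 2 - rect_pt t mn)\<^sup>2"

text \<open>The cube of \<open>5 / sqrt t\<close> is weakened to \<open>125 / t\<close>, which still
  tends to \<open>0\<close> as \<open>t\<close> grows.\<close>

lemma inverse_cube_sqrt_le:
  assumes "t \<ge> 1" "sqrt t / 5 * ht mn \<le> \<rho>"
  shows "1 / \<rho> ^ 3 \<le> 125 / t * (1 / ht mn ^ 3)" "\<rho> > 0"
proof -
  have st: "sqrt t \<ge> 1" using assms by simp
  have h: "ht mn > 0" using ht_ge_1[of mn] by linarith
  then show "\<rho> > 0" using assms st by (smt (verit) divide_pos_pos mult_pos_pos)
  have "1 / \<rho> ^ 3 \<le> (1 / (sqrt t / 5) ^ 3) * (1 / ht mn ^ 3)"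
    by (rule inverse_cube_le) (use assms in auto)
  also have "\<dots> \<le> 125 / t * (1 / ht mn ^ 3)"
  proof (rule mult_right_mono)
    have "t * 1 \<le> t * sqrt t" using assms st by (intro mult_left_mono) auto
    also have "\<dots> = sqrt t ^ 3" using assms by (simp add: power3_eq_cube)
    finally have "125 / sqrt t ^ 3 \<le> 125 / t" using assms by (intro divide_left_mono) auto
    then show "1 / (sqrt t / 5) ^ 3 \<le> 125 / t" by (simp add: power_divide)
  qed (use h in auto)
  finally show "1 / \<rho> ^ 3 \<le> 125 / t * (1 / ht mn ^ 3)" .
qed

text \<open>The imaginary parts are half-odd multiples of \<open>t\<close>, so every row of the
  lattice, including \<open>n = 0\<close>, moves away as \<open>t\<close> grows.\<close>

lemma rect_y_denoms:
  assumes t: "t \<ge> 1"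
  shows "sqrt t / 5 * ht mn \<le> norm ((1 + \<i> * of_real t) / 2 - rect_pt t mn)"
    "sqrt t / 5 * ht mn \<le> norm (\<i> * of_real t / 2 - rect_pt t mn)"
proof -
  have "(1 + \<bar>of_int (snd mn)\<bar>) / 4 * t \<le> \<bar>1/2 - real_of_int (snd mn)\<bar> * t"
    using t abs_half_minus_int_ge(2)[of "snd mn"] by (intro mult_right_mono) auto
  also have "\<dots> = \<bar>(1/2 - real_of_int (snd mn)) * t\<bar>" using t by (simp add: abs_mult)
  also have "(1/2 - real_of_int (snd mn)) * t = t / 2 - of_int (snd mn) * t" by (simp add: algebra_simps)
  finally have im: "(1 + \<bar>of_int (snd mn)\<bar>) * t / 4 \<le> \<bar>t / 2 - of_int (snd mn) * t\<bar>" by simp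
  show "sqrt t / 5 * ht mn \<le> norm ((1 + \<i> * of_real t) / 2 - rect_pt t mn)"
    "sqrt t / 5 * ht mn \<le> norm (\<i> * of_real t / 2 - rect_pt t mn)"
    using norm_rect_ge[of t "fst mn" _ "snd mn", OF t] im abs_half_minus_int_ge(1)[of "fst mn"] by simp_all
qed

lemma norm_rect_y_le:
  assumes t: "t \<ge> 1"
  shows "norm (rect_y t mn) \<le> 125 / t * (1 / ht mn ^ 3)"
proof -
  define \<rho> where "\<rho> = sqrt t / 5 * ht mn"
  have "norm (rect_y t mn) \<le> 1 / \<rho> ^ 3"
    unfolding rect_y_def
  proof (rule norm_inverse_square_diff_le)
    show "\<rho> > 0" unfolding \<rho>_def by (rule inverse_cube_sqrt_le(2)[OF t order_refl])
    have "(1 + \<i> * of_real t) / 2 - rect_pt t mn - (\<i> * of_real t / 2 - rect_pt t mn) = 1/2"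
      by (simp add: add_divide_distrib)
    then show "norm ((1 + \<i> * of_real t) / 2 - rect_pt t mn - (\<i> * of_real t / 2 - rect_pt t mn)) = 1/2"
      by (simp only: norm_divide norm_one norm_numeral)
  qed (use rect_y_denoms[OF t, of mn] in \<open>auto simp: \<rho>_def\<close>)
  also have "\<dots> \<le> 125 / t * (1 / ht mn ^ 3)"
    by (rule inverse_cube_sqrt_le(1)[OF t]) (simp add: \<rho>_def)
  finally show ?thesis .
qed

lemma norm_rect_x_le_aux:
  assumes "0 < \<rho>" "\<rho> \<le> norm (1/2 - rect_pt t mn)" "\<rho> \<le> norm (rect_pt t mn)"
  shows "norm (rect_x t mn) \<le> 1 / \<rho> ^ 3"
  using norm_inverse_square_diff_le[of \<rho> "1/2 - rect_pt t mn" "- rect_pt t mn"] assms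
  by (simp add: rect_x_def)

text \<open>Only rows \<open>n \<noteq> 0\<close> move away with \<open>t\<close>; in the row
  \<open>n = 0\<close> the terms are independent of \<open>t\<close>.\<close>

lemma norm_rect_x_le_decay:
  assumes t: "t \<ge> 1" and n: "snd mn \<noteq> 0"
  shows "norm (rect_x t mn) \<le> 125 / t * (1 / ht mn ^ 3)"
proof -
  define \<rho> where "\<rho> = sqrt t / 5 * ht mn"
  have "1 \<le> \<bar>real_of_int (snd mn)\<bar>" using n by linarith
  then have "(1 + \<bar>real_of_int (snd mn)\<bar>) / 4 * t \<le> \<bar>real_of_int (snd mn)\<bar> * t"
    using t by (intro mult_right_mono) auto
  also have "\<dots> = \<bar>of_int (snd mn) * t\<bar>" using t by (simp add: abs_mult)
  finally have im: "(1 + \<bar>of_int (snd mn)\<bar>) * t / 4 \<le> \<bar>of_int (snd mn) * t\<bar>" by simp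
  have "norm (rect_x t mn) \<le> 1 / \<rho> ^ 3"
  proof (rule norm_rect_x_le_aux)
    show "\<rho> > 0" unfolding \<rho>_def by (rule inverse_cube_sqrt_le(2)[OF t order_refl])
    show "\<rho> \<le> norm (1/2 - rect_pt t mn)" "\<rho> \<le> norm (rect_pt t mn)"
      using norm_rect_ge[of t "fst mn" _ "snd mn", OF t] im abs_half_minus_int_ge(1)[of "fst mn"]
      by (simp_all add: \<rho>_def)
  qed
  also have "\<dots> \<le> 125 / t * (1 / ht mn ^ 3)"
    by (rule inverse_cube_sqrt_le(1)[OF t]) (simp add: \<rho>_def)
  finally show ?thesis .
qed

text \<open>A bound uniform in \<open>t\<close> that includes the row \<open>n = 0\<close>, as the
  continuity of \<open>rect_e1\<close> on all of \<open>{1..}\<close> requires. With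
  \<open>N\<close> the larger index, both norms are at least \<open>N / 2\<close>, and
  \<open>ht mn \<le> 2 N\<close>.\<close>

lemma rect_x_denoms:
  assumes t: "t \<ge> 1" and mn: "mn \<noteq> (0,0)"
  shows "1/4 * ht mn \<le> norm (1/2 - rect_pt t mn)" "1/4 * ht mn \<le> norm (rect_pt t mn)"
proof -
  define N where "N = max \<bar>real_of_int (fst mn)\<bar> \<bar>of_int (snd mn)\<bar>"
  have ht: "ht mn \<le> 2 * N" unfolding N_def by (rule ht_le_max[OF mn])
  have "\<bar>real_of_int (snd mn)\<bar> * 1 \<le> \<bar>real_of_int (snd mn)\<bar> * t"
    using t by (intro mult_left_mono) auto
  also have "\<dots> = \<bar>of_int (snd mn) * t\<bar>" using t by (simp add: abs_mult)
  finally have im: "\<bar>real_of_int (snd mn)\<bar> \<le> \<bar>of_int (snd mn) * t\<bar>" by simp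
  have key: "1/4 * ht mn \<le> norm z" if "\<bar>real_of_int (fst mn)\<bar> / 2 \<le> \<bar>Re z\<bar>" "\<bar>real_of_int (snd mn)\<bar> \<le> \<bar>Im z\<bar>" for z
  proof -
    have "N / 2 \<le> norm z" using that abs_Re_le_cmod[of z] abs_Im_le_cmod[of z] by (auto simp: N_def max_def)
    then show ?thesis using ht by linarith
  qed
  show "1/4 * ht mn \<le> norm (1/2 - rect_pt t mn)"
    by (rule key) (use im abs_half_minus_int_ge(1)[of "fst mn"] in auto)
  show "1/4 * ht mn \<le> norm (rect_pt t mn)"
    by (rule key) (use im in auto)
qed

lemma norm_rect_x_le:
  assumes t: "t \<ge> 1" and mn: "mn \<noteq> (0,0)"
  shows "norm (rect_x t mn) \<le> 64 * (1 / ht mn ^ 3)"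
proof -
  have "norm (rect_x t mn) \<le> 1 / (1/4 * ht mn) ^ 3"
    by (rule norm_rect_x_le_aux) (use ht_ge_1[of mn] rect_x_denoms[OF assms] in auto)
  then show ?thesis by (simp add: power_mult_distrib power_divide)
qed

definition rect_e1 :: "real \<Rightarrow> complex" where
  "rect_e1 t = wp_lattice 1 (\<i> * of_real t) (1/2)"
definition rect_e2 :: "real \<Rightarrow> complex" where
  "rect_e2 t = wp_lattice 1 (\<i> * of_real t) ((1 + \<i> * of_real t) / 2)"
definition rect_e3 :: "real \<Rightarrow> complex" where
  "rect_e3 t = wp_lattice 1 (\<i> * of_real t) (\<i> * of_real t / 2)"

lemma rect_lattice: "t > 0 \<Longrightarrow> complex_lattice 1 (\<i> * of_real t)"
  by standard simp

lemma rect_e_values: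
  assumes "t > 0"
  shows "rect_e1 t \<noteq> rect_e2 t" "rect_e1 t \<noteq> rect_e3 t" "rect_e1 t + rect_e2 t + rect_e3 t = 0"
    "g2_lattice 1 (\<i> * of_real t) = - 4 * (rect_e1 t * rect_e2 t + rect_e1 t * rect_e3 t + rect_e2 t * rect_e3 t)"
    "g3_lattice 1 (\<i> * of_real t) = 4 * rect_e1 t * rect_e2 t * rect_e3 t"
  using complex_lattice.half_period_values[OF rect_lattice[OF assms]]
  by (simp_all add: rect_e1_def rect_e2_def rect_e3_def)

text \<open>Conjugation preserves a rectangular lattice. It fixes \<open>1/2\<close>, changes the
  sign of \<open>\<i> t / 2\<close>, and moves \<open>(1 + \<i> t) / 2\<close> by a period.\<close>

lemma rect_e_real:
  assumes t: "t > 0"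
  shows "rect_e1 t = of_real (Re (rect_e1 t))" "rect_e2 t = of_real (Re (rect_e2 t))"
    "rect_e3 t = of_real (Re (rect_e3 t))"
proof -
  interpret complex_lattice 1 "\<i> * of_real t" by (rule rect_lattice[OF t])
  have cnj: "cnj (wp z) = wp (cnj z)" for z
    using wp_lattice_uminus_w2[of 1 "\<i> * of_real t"] by (simp add: cnj_wp_lattice)
  have real: "z = of_real (Re z)" if "cnj z = z" for z using that by (simp add: complex_eq_iff)
  have "cnj (rect_e1 t) = rect_e1 t" by (simp add: rect_e1_def cnj)
  then show "rect_e1 t = of_real (Re (rect_e1 t))" by (rule real)
  have "cnj (rect_e3 t) = rect_e3 t"
    using wp_minus[of "\<i> * of_real t / 2"] by (simp add: rect_e3_def cnj)
  then show "rect_e3 t = of_real (Re (rect_e3 t))" by (rule real)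
  have A: "(1 - \<i> * of_real t) / 2 = (1 + \<i> * of_real t) / 2 - \<i> * of_real t" by (simp add: field_simps)
  have B: "(1 + \<i> * of_real t) / 2 - \<i> * of_real t \<notin> \<Lambda>"
    using half_periods_notin(3) Lambda_diff_iff[OF w_in_Lambda(2)] by blast
  from wp_add_w2[OF B] have "wp ((1 - \<i> * of_real t) / 2) = wp ((1 + \<i> * of_real t) / 2)"
    by (simp only: A diff_add_cancel)
  then have "cnj (rect_e2 t) = rect_e2 t" by (simp add: rect_e2_def cnj)
  then show "rect_e2 t = of_real (Re (rect_e2 t))" by (rule real)
qed

text \<open>The square lattice is invariant under multiplication by \<open>\<i>\<close>, which fixes the half period
  \<open>(1 + \<i>)/2\<close> and changes the sign of \<open>\<wp>\<close>.\<close>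
lemma rect_e2_square: "rect_e2 1 = 0"
proof -
  interpret complex_lattice 1 "\<i> * of_real 1" by (rule rect_lattice) simp
  define z where "z = (1 + \<i>) / 2"
  have z: "z \<notin> \<Lambda>" using half_periods_notin(3) by (simp add: z_def)
  have "wp_lattice (\<i> * 1) (\<i> * \<i>) (\<i> * z) = wp_lattice 1 \<i> z / \<i>\<^sup>2" by (rule wp_lattice_scale)
  moreover have "wp_lattice (\<i> * 1) (\<i> * \<i>) = wp_lattice 1 \<i>"
    using wp_lattice_uminus_w2[of \<i> 1] wp_lattice_swap[of 1 \<i>] by simp
  ultimately have "wp (\<i> * z) = - wp z" by simp
  moreover have "\<i> * z + 1 = z" by (simp add: z_def field_simps)
  moreover have "\<i> * z \<notin> \<Lambda>" using z Lambda_add_iff[OF w_in_Lambda(1), of "\<i> * z"] \<open>\<i> * z + 1 = z\<close> by simp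
  ultimately have "wp z = - wp z" using wp_add_w1[of "\<i> * z"] by simp
  then show ?thesis by (simp add: rect_e2_def z_def)
qed

text \<open>The constant \<open>4\<close> is the principal part \<open>1 / z^2\<close> at
  \<open>z = 1/2\<close>.\<close>

lemma rect_e1_eq: "rect_e1 t = 4 + infsum (rect_x t) (UNIV - {(0,0)})"
  by (simp add: rect_e1_def wp_lattice_def rect_x_def[abs_def] rect_pt_def power_divide)

lemma rect_y_has_sum:
  assumes t: "t \<ge> 1"
  shows "(rect_y t has_sum (rect_e2 t - rect_e3 t)) UNIV"
proof -
  interpret complex_lattice 1 "\<i> * of_real t" by (rule rect_lattice) (use t in simp)
  show ?thesis
    using has_sum_wp_diff[OF half_periods_notin(3,2)]
    by (simp add: rect_y_def[abs_def] rect_e2_def rect_e3_def rect_pt_def)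
qed

lemma continuous_on_infsum_dominated_ht:
  fixes f :: "real \<Rightarrow> int \<times> int \<Rightarrow> complex"
  assumes "\<And>t mn. t \<in> S \<Longrightarrow> mn \<in> A \<Longrightarrow> norm (f t mn) \<le> C * (1 / ht mn ^ 3)"
    and "\<And>mn. mn \<in> A \<Longrightarrow> continuous_on S (\<lambda>t. f t mn)"
  shows "continuous_on S (\<lambda>t. infsum (f t) A)"
proof (rule uniform_limit_theorem)
  show "uniform_limit S (\<lambda>X t. \<Sum>mn\<in>X. f t mn) (\<lambda>t. infsum (f t) A) (finite_subsets_at_top A)"
    by (rule Weierstrass_m_test_general[OF _ summable_on_cmult_right[OF summable_on_inverse_ht_cube, of C]])
       (use assms(1) in auto)
  show "\<forall>\<^sub>F X in finite_subsets_at_top A. continuous_on S (\<lambda>t. \<Sum>mn\<in>X. f t mn)"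
    by (rule eventually_finite_subsets_at_top_weakI) (auto intro!: continuous_intros assms(2))
qed simp

lemma continuous_rect_x: "continuous_on {1..} (\<lambda>t. infsum (rect_x t) (UNIV - {(0,0)}))"
proof (rule continuous_on_infsum_dominated_ht)
  fix mn :: "int \<times> int" assume mn: "mn \<in> UNIV - {(0,0)}"
  show "norm (rect_x t mn) \<le> 64 * (1 / ht mn ^ 3)" if "t \<in> {1..}" for t
    using norm_rect_x_le that mn by simp
  have "1/2 - rect_pt t mn \<noteq> 0" "rect_pt t mn \<noteq> 0" if "t \<in> {1..}" for t
    using rect_x_denoms[of t mn] ht_ge_1[of mn] that mn by (smt (verit) Diff_iff atLeast_iff divide_pos_pos mult_pos_pos norm_zero singletonI)+
  then show "continuous_on {1..} (\<lambda>t. rect_x t mn)"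
    unfolding rect_x_def rect_pt_def lattice_pt_def by (intro continuous_intros) auto
qed

lemma continuous_rect_y: "continuous_on {1..} (\<lambda>t. infsum (rect_y t) UNIV)"
proof (rule continuous_on_infsum_dominated_ht)
  fix mn :: "int \<times> int"
  show "norm (rect_y t mn) \<le> 125 * (1 / ht mn ^ 3)" if "t \<in> {1..}" for t
  proof -
    have "125 / t * (1 / ht mn ^ 3) \<le> 125 * (1 / ht mn ^ 3)"
      using that ht_ge_1[of mn] by (intro mult_right_mono) (auto simp: divide_le_eq)
    then show ?thesis using norm_rect_y_le[of t mn] that by simp
  qed
  have "(1 + \<i> * of_real t) / 2 - rect_pt t mn \<noteq> 0" "\<i> * of_real t / 2 - rect_pt t mn \<noteq> 0" if t: "t \<in> {1..}" for t
    using rect_y_denoms[of t mn] inverse_cube_sqrt_le(2)[OF _ order_refl, of t mn] t by auto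
  then show "continuous_on {1..} (\<lambda>t. rect_y t mn)"
    unfolding rect_y_def rect_pt_def lattice_pt_def by (intro continuous_intros) auto
qed

lemma norm_has_sum_decay:
  assumes "(f has_sum s) A" and "t \<ge> 1"
    and "\<And>mn. mn \<in> A \<Longrightarrow> norm (f mn) \<le> 125 / t * (1 / ht mn ^ 3)"
  shows "norm s \<le> 125 / t * infsum (\<lambda>mn. 1 / ht mn ^ 3) UNIV"
proof -
  have "norm s \<le> 125 / t * infsum (\<lambda>mn. 1 / ht mn ^ 3) A"
    by (rule norm_infsum_le[OF assms(1) has_sum_cmult_right[OF has_sum_infsum[OF summable_on_inverse_ht_cube]]])
       (use assms(3) in auto)
  also have "\<dots> \<le> 125 / t * infsum (\<lambda>mn. 1 / ht mn ^ 3) UNIV"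
  proof (rule mult_left_mono)
    have "0 \<le> 1 / ht mn ^ 3" for mn using ht_ge_1[of mn] by simp
    then show "infsum (\<lambda>mn. 1 / ht mn ^ 3) A \<le> infsum (\<lambda>mn. 1 / ht mn ^ 3) UNIV"
      by (intro infsum_mono2 summable_on_inverse_ht_cube) auto
  qed (use assms(2) in auto)
  finally show ?thesis .
qed

text \<open>Midpoint convexity of \<open>1 / x^2\<close> at the points \<open>m - 1/2\<close> and
  \<open>m + 1/2\<close>, which lie on the same side of \<open>0\<close>.\<close>

lemma inverse_square_convexity:
  fixes m :: int
  assumes "m \<noteq> 0"
  shows "2 / (of_int m)\<^sup>2 \<le> 1 / (1/2 - real_of_int m)\<^sup>2 + 1 / (1/2 + real_of_int m)\<^sup>2"
proof -
  define x where "x = real_of_int m"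
  have "1 \<le> \<bar>x\<bar>" using assms unfolding x_def by linarith
  then have q: "1 \<le> x\<^sup>2" by (metis abs_le_square_iff abs_one one_power2)
  have nz: "x \<noteq> 0" "1/2 - x \<noteq> 0" "1/2 + x \<noteq> 0" using \<open>1 \<le> \<bar>x\<bar>\<close> by auto
  have "1 / (1/2 - x)\<^sup>2 + 1 / (1/2 + x)\<^sup>2 - 2 / x\<^sup>2
      = ((3/2) * x\<^sup>2 - 1/8) / (x\<^sup>2 * ((1/2 - x)\<^sup>2 * (1/2 + x)\<^sup>2))"
  proof -
    have "((1/2 - x)\<^sup>2 + (1/2 + x)\<^sup>2) * x\<^sup>2 - 2 * ((1/2 - x)\<^sup>2 * (1/2 + x)\<^sup>2) = (3/2) * x\<^sup>2 - 1/8"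
      by (simp add: power2_eq_square algebra_simps)
    moreover have "1 / A + 1 / B - 2 / Y = ((A + B) * Y - 2 * (A * B)) / (Y * (A * B))"
      if "A \<noteq> 0" "B \<noteq> 0" "Y \<noteq> 0" for A B Y :: real
      using that by (simp add: divide_simps)
    ultimately show ?thesis using nz by simp
  qed
  also have "\<dots> \<ge> 0" using q by (intro divide_nonneg_nonneg) auto
  finally show ?thesis by (simp add: x_def)
qed

text \<open>This row does not shrink with \<open>t\<close>, so it needs a sign rather than a size
  estimate. Pairing \<open>m\<close> with \<open>- m\<close> reduces its sign to the convexity
  inequality.\<close>

lemma rect_x_row_nonneg:
  assumes s: "(rect_x t has_sum s) {mn. mn \<noteq> (0,0) \<and> snd mn = 0}"
  shows "0 \<le> Re s"
proof -
  let ?A = "{mn::int\<times>int. mn \<noteq> (0,0) \<and> snd mn = 0}"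
  have "((\<lambda>(m,n). rect_x t (- m, n)) has_sum s) ?A"
    using s by (subst has_sum_reindex_bij_witness[of _ "\<lambda>(m,n). (-m,n)" "\<lambda>(m,n). (-m,n)"]) auto
  then have "((\<lambda>mn. Re (rect_x t mn) + Re ((\<lambda>(m,n). rect_x t (- m, n)) mn)) has_sum (Re s + Re s)) ?A"
    by (intro has_sum_add has_sum_Re s)
  moreover have "0 \<le> Re (rect_x t mn) + Re ((\<lambda>(m,n). rect_x t (- m, n)) mn)" if mn: "mn \<in> ?A" for mn
  proof -
    obtain m where m: "mn = (m, 0)" "m \<noteq> 0" using mn by (cases mn) auto
    have eq: "rect_x t (k, 0) = of_real (1 / (1/2 - of_int k)\<^sup>2 - 1 / (of_int k)\<^sup>2)" for k
      by (simp add: rect_x_def rect_pt_def lattice_pt_def)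
    show ?thesis using inverse_square_convexity[OF m(2)] unfolding m(1) prod.case eq Re_complex_of_real by simp
  qed
  ultimately have "0 \<le> Re s + Re s" by (rule has_sum_nonneg)
  then show ?thesis by simp
qed

text \<open>The row \<open>n = 0\<close> contributes nonnegatively and the remaining rows decay. The
  bound keeps the denominator of the ratio away from \<open>0\<close> for large
  \<open>t\<close>.\<close>

lemma Re_rect_e1_ge:
  assumes t: "t \<ge> 1"
  shows "4 - 125 / t * infsum (\<lambda>mn. 1 / ht mn ^ 3) UNIV \<le> Re (rect_e1 t)"
proof -
  let ?A = "{mn::int\<times>int. mn \<noteq> (0,0) \<and> snd mn = 0}" and ?B = "{mn::int\<times>int. snd mn \<noteq> 0}"
  have "rect_x t summable_on (UNIV - {(0,0)})"
    by (rule summable_on_dominated_ht[of _ _ 64]) (use norm_rect_x_le[OF t] in auto)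
  then have "rect_x t summable_on ?A" "rect_x t summable_on ?B"
    by (auto elim!: summable_on_subset_banach)
  then obtain a b where a: "(rect_x t has_sum a) ?A" and b: "(rect_x t has_sum b) ?B"
    by (auto simp: summable_on_def)
  have "?A \<union> ?B = UNIV - {(0,0)}" "?A \<inter> ?B = {}" by auto
  then have "(rect_x t has_sum (a + b)) (UNIV - {(0,0)})"
    using has_sum_Un_disjoint[OF a b] by simp
  then have "rect_e1 t = 4 + (a + b)" by (simp add: rect_e1_eq infsumI)
  moreover have "norm b \<le> 125 / t * infsum (\<lambda>mn. 1 / ht mn ^ 3) UNIV"
    by (rule norm_has_sum_decay[OF b t]) (use norm_rect_x_le_decay[OF t] in auto)
  moreover have "- norm b \<le> Re b" using abs_Re_le_cmod[of b] by linarith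
  ultimately show ?thesis using rect_x_row_nonneg[OF a] by simp
qed

section \<open>Existence of a lattice with prescribed real roots\<close>

lemma rect_ratio_exists:
  assumes T: "0 < T" "T \<le> 1/2"
  obtains t where "t \<ge> 1" "rect_e2 t - rect_e3 t = of_real T * (rect_e1 t - rect_e3 t)"
proof -
  define x y where "x = (\<lambda>t. Re (rect_e1 t))" and "y = (\<lambda>t. Re (rect_e2 t - rect_e3 t))"
  define W where "W = infsum (\<lambda>mn. 1 / ht mn ^ 3) UNIV"
  \<comment> \<open>By \<open>e1 + e2 + e3 = 0\<close>, twice \<open>e1 - e3\<close> equals
    \<open>3 e1 + (e2 - e3)\<close>. The ratio is thus expressed through the two quantities whose
    series have been estimated.\<close>
  define l where "l = (\<lambda>t. 2 * y t / (3 * x t + y t))"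
  have sum0: "3 * x t + y t = 2 * (Re (rect_e1 t) - Re (rect_e3 t))" if "t \<ge> 1" for t
  proof -
    have "Re (rect_e1 t + rect_e2 t + rect_e3 t) = 0" using rect_e_values(3)[of t] that by simp
    then show ?thesis by (simp add: x_def y_def)
  qed
  have nz: "3 * x t + y t \<noteq> 0" if t: "t \<ge> 1" for t
  proof -
    have "rect_e1 t \<noteq> rect_e3 t" "t > 0" using rect_e_values(2)[of t] t by auto
    then have "Re (rect_e1 t) \<noteq> Re (rect_e3 t)" using rect_e_real[of t] by metis
    then show ?thesis by (simp add: sum0[OF t])
  qed
  have "continuous_on {1..} x"
    unfolding x_def rect_e1_eq by (intro continuous_intros continuous_rect_x)
  moreover have "continuous_on {1..} y"
  proof -
    have "continuous_on {1..} (\<lambda>t. Re (infsum (rect_y t) UNIV))" by (intro continuous_intros continuous_rect_y)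
    then show ?thesis
      by (rule continuous_on_eq) (auto simp: y_def infsumI[OF rect_y_has_sum])
  qed
  ultimately have cont: "continuous_on {1..} l"
    unfolding l_def by (intro continuous_intros) (use nz in auto)
  have l1: "l 1 = 1/2"
  proof -
    have "Re (rect_e1 1 + rect_e2 1 + rect_e3 1) = 0" using rect_e_values(3)[of 1] by simp
    then have "y 1 = x 1" by (simp add: x_def y_def rect_e2_square)
    then show ?thesis using nz[of 1] by (simp add: l_def)
  qed
  have W: "W \<ge> 0" unfolding W_def using ht_ge_1 by (intro infsum_nonneg) (simp add: order_trans[OF zero_le_one])
  \<comment> \<open>Chosen so that the tail bound \<open>125 W / b\<close> is at most
    \<open>T\<close>. Then \<open>y b \<le> T\<close>, while the denominator of \<open>l b\<close>
    is at least \<open>3 (4 - T) - T\<close>, hence at least \<open>2\<close>.\<close>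
  define b where "b = 1 + 125 * W / T"
  have b1: "b \<ge> 1" using W T by (simp add: b_def)
  have dec: "125 / b * W \<le> T"
  proof -
    have "T * b = T + 125 * W" using T by (simp add: b_def algebra_simps)
    then show ?thesis using b1 T by (simp add: divide_le_eq)
  qed
  have "norm (rect_e2 b - rect_e3 b) \<le> 125 / b * W"
    unfolding W_def by (rule norm_has_sum_decay[OF rect_y_has_sum[OF b1] b1]) (rule norm_rect_y_le[OF b1])
  then have yb: "y b \<le> T" "- T \<le> y b"
    using dec abs_Re_le_cmod[of "rect_e2 b - rect_e3 b"] by (auto simp: y_def)
  have xb: "x b \<ge> 4 - T" using Re_rect_e1_ge[OF b1] dec by (simp add: x_def W_def)
  have "l b \<le> T"
  proof -
    have den: "3 * x b + y b \<ge> 2" using xb yb T by linarith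
    have "2 * y b \<le> T * 2" using yb by simp
    also have "\<dots> \<le> T * (3 * x b + y b)" using den T by (intro mult_left_mono) auto
    finally show ?thesis using den by (simp add: l_def divide_le_eq)
  qed
  then obtain t where t: "1 \<le> t" "t \<le> b" "l t = T"
    using IVT2'[of l b T 1] l1 T b1 continuous_on_subset[OF cont, of "{1..b}"] by auto
  have "2 * y t = T * (3 * x t + y t)"
    using t(3) nz[OF t(1)] by (simp add: l_def nonzero_divide_eq_eq)
  then have "Re (rect_e2 t) - Re (rect_e3 t) = T * (Re (rect_e1 t) - Re (rect_e3 t))"
    unfolding sum0[OF t(1)] by (simp only: y_def minus_complex.simps) (simp add: algebra_simps)
  then have "complex_of_real (Re (rect_e2 t)) - of_real (Re (rect_e3 t))
      = of_real T * (of_real (Re (rect_e1 t)) - of_real (Re (rect_e3 t)))"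
    by (metis of_real_diff of_real_mult)
  then have "rect_e2 t - rect_e3 t = of_real T * (rect_e1 t - rect_e3 t)"
    using rect_e_real[of t] t(1) by simp
  with t(1) show ?thesis by (rule that)
qed

text \<open>Two triples with sum zero and the same ratio of differences are proportional, here by a
  factor \<open>s\<close>. A homothety by \<open>c\<close> divides the half-period values by
  \<open>c^2\<close>, so \<open>c\<close> is a complex square root of \<open>s\<close>; negative
  \<open>s\<close> is thereby covered, as is \<open>E1 < E3\<close>.\<close>

lemma lattice_exists_ratio:
  fixes E1 E2 E3 T :: real
  assumes "E1 + E2 + E3 = 0" "E1 \<noteq> E3" "E2 - E3 = T * (E1 - E3)" "0 < T" "T \<le> 1/2"
  shows "\<exists>w1 w2. Im (w2 / w1) \<noteq> 0 \<and> g2_lattice w1 w2 = of_real (- 4 * (E1 * E2 + E1 * E3 + E2 * E3))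
           \<and> g3_lattice w1 w2 = of_real (4 * E1 * E2 * E3)"
proof -
  obtain t where t: "t \<ge> 1" "rect_e2 t - rect_e3 t = of_real T * (rect_e1 t - rect_e3 t)"
    using rect_ratio_exists[OF assms(4,5)] by blast
  have t0: "t > 0" using t by simp
  note vals = rect_e_values[OF t0]
  define s where "s = (rect_e1 t - rect_e3 t) / of_real (E1 - E3)"
  have E13: "of_real E1 - of_real E3 \<noteq> (0::complex)" using assms(2) by simp
  have s13: "rect_e1 t - rect_e3 t = s * (of_real E1 - of_real E3)" using E13 by (simp add: s_def)
  have s: "s \<noteq> 0" using vals(2) E13 s13 by auto
  have E23: "of_real E2 - of_real E3 = (of_real T * (of_real E1 - of_real E3) :: complex)"
    using assms(3) by (metis of_real_diff of_real_mult)
  have Esum: "of_real E1 + of_real E2 + of_real E3 = (0::complex)"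
    using assms(1) by (metis of_real_0 of_real_add)
  have s23: "rect_e2 t - rect_e3 t = s * (of_real E2 - of_real E3)"
    using t(2) s13 E23 by (simp add: mult.left_commute)
  have "3 * (rect_e3 t - s * of_real E3) = 0" using s13 s23 vals(3) Esum by algebra
  then have e3: "rect_e3 t = s * of_real E3" by simp
  then have e1: "rect_e1 t = s * of_real E1" and e2: "rect_e2 t = s * of_real E2"
    using s13 s23 by (simp_all add: algebra_simps)
  define c where "c = csqrt s"
  have c: "c\<^sup>2 = s" by (simp add: c_def)
  then have c0: "c \<noteq> 0" using s by auto
  have c46: "c ^ 4 = s\<^sup>2" "c ^ 6 = s ^ 3" unfolding c[symmetric] by (simp_all flip: power_mult)
  show ?thesis
  proof (intro exI conjI)
    show "Im ((c * (\<i> * of_real t)) / (c * 1)) \<noteq> 0" using c0 t0 by simp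
    show "g2_lattice (c * 1) (c * (\<i> * of_real t)) = of_real (- 4 * (E1 * E2 + E1 * E3 + E2 * E3))"
      unfolding g2_lattice_scale vals(4) e1 e2 e3 c46 using s
      by (simp add: field_simps power2_eq_square)
    show "g3_lattice (c * 1) (c * (\<i> * of_real t)) = of_real (4 * E1 * E2 * E3)"
      unfolding g3_lattice_scale vals(5) e1 e2 e3 c46 using s
      by (simp add: field_simps power3_eq_cube)
  qed
qed

lemma lattice_exists:
  fixes E1 E2 E3 :: real
  assumes sum: "E1 + E2 + E3 = 0" and "E1 > E2" "E2 > E3"
  shows "\<exists>w1 w2. Im (w2 / w1) \<noteq> 0 \<and> g2_lattice w1 w2 = of_real (- 4 * (E1 * E2 + E1 * E3 + E2 * E3))
           \<and> g3_lattice w1 w2 = of_real (4 * E1 * E2 * E3)"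
proof (cases "(E2 - E3) / (E1 - E3) \<le> 1/2")
  case True
  show ?thesis by (rule lattice_exists_ratio[OF sum _ _ _ True]) (use assms in auto)
next
  case False
  \<comment> \<open>Exchanging the outer roots replaces the ratio by \<open>1\<close> minus the
    ratio; the invariants are symmetric in the roots.\<close>
  define T where "T = (E2 - E1) / (E3 - E1)"
  have T: "0 < T" "T \<le> 1/2" "E2 - E1 = T * (E3 - E1)"
    using False assms by (auto simp: T_def field_simps)
  have "\<exists>w1 w2. Im (w2 / w1) \<noteq> 0 \<and> g2_lattice w1 w2 = of_real (- 4 * (E3 * E2 + E3 * E1 + E2 * E1))
           \<and> g3_lattice w1 w2 = of_real (4 * E3 * E2 * E1)"
    by (rule lattice_exists_ratio[OF _ _ T(3,1,2)]) (use assms in auto)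
  then show ?thesis by (simp add: mult_ac add_ac)
qed

text \<open>Existence is what makes the choice in \<open>weierstrass_p\<close> satisfy its
  specification. Nothing further is known of the chosen lattice, so the comparison must work for an
  arbitrary one.\<close>

lemma weierstrass_p_lattice:
  assumes "\<exists>w1 w2. Im (w2 / w1) \<noteq> 0 \<and> g2_lattice w1 w2 = g2 \<and> g3_lattice w1 w2 = g3"
  obtains w1 w2 where "complex_lattice w1 w2" "g2_lattice w1 w2 = g2" "g3_lattice w1 w2 = g3"
    "weierstrass_p g2 g3 = wp_lattice w1 w2"
proof -
  define P where "P = (\<lambda>L. Im (snd L / fst L) \<noteq> 0 \<and> g2_lattice (fst L) (snd L) = g2 \<and> g3_lattice (fst L) (snd L) = g3)"
  define L where "L = (SOME L. P L)"
  have "\<exists>L. P L" using assms by (auto simp: P_def)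
  then have "P L" unfolding L_def by (rule someI_ex)
  moreover have "weierstrass_p g2 g3 = wp_lattice (fst L) (snd L)"
    by (simp add: weierstrass_p_def L_def P_def Let_def)
  ultimately show ?thesis by (intro that[of "fst L" "snd L"]) (auto simp: P_def complex_lattice_def)
qed

section \<open>Comparison of the two solutions\<close>

theorem theorem4:
  fixes \<kappa> \<delta> :: real and phi psi :: "real \<Rightarrow> real"
  assumes "0 < \<kappa>" and "\<kappa> < 1"
    and "0 < \<delta>"
    and "phi 0 = 0"
    and "\<And>u. \<bar>u\<bar> < \<delta> \<Longrightarrow> u_of \<kappa> (phi u) = u"
    and "psi 0 = 0"
    and "continuous_on {-\<delta><..<\<delta>} psi"
    and "\<And>u. \<bar>u\<bar> < \<delta> \<Longrightarrow> sin (psi u) = \<kappa> * sin (phi u)"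
  shows "\<exists>\<epsilon>>0. \<forall>u. 0 < \<bar>u\<bar> \<and> \<bar>u\<bar> < \<epsilon> \<longrightarrow>
           complex_of_real (cos (psi u)) =
             1 - complex_of_real (\<kappa>\<^sup>2 / 2) /
                   (weierstrass_p (of_real (4/3 - \<kappa>\<^sup>2)) (of_real (8/27 - \<kappa>\<^sup>2 / 3))
                      (complex_of_real u) + 1/3)"
proof -
  \<comment> \<open>The cubic is \<open>P (4 P^2 - 4 P + \<kappa>^2)\<close> in
    \<open>P = wp + 1/3\<close>, with nonzero roots \<open>(1 + k)/2\<close> and
    \<open>(1 - k)/2\<close>; \<open>0 < k < 1\<close> puts the three roots in strict order.\<close>
  define k where "k = sqrt (1 - \<kappa>\<^sup>2)"
  have "\<kappa>\<^sup>2 < 1" "\<kappa>\<^sup>2 > 0" using assms(1,2) by (simp_all add: power_less_one_iff)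
  then have k: "0 < k" "k < 1" "k\<^sup>2 = 1 - \<kappa>\<^sup>2" by (simp_all add: k_def)
  have ex: "\<exists>w1 w2. Im (w2 / w1) \<noteq> 0
      \<and> g2_lattice w1 w2 = of_real (- 4 * ((1/6 + k/2) * (1/6 - k/2) + (1/6 + k/2) * (- 1/3) + (1/6 - k/2) * (- 1/3)))
      \<and> g3_lattice w1 w2 = of_real (4 * (1/6 + k/2) * (1/6 - k/2) * (- 1/3))"
    by (rule lattice_exists) (use k in auto)
  have g: "- 4 * ((1/6 + k/2) * (1/6 - k/2) + (1/6 + k/2) * (- 1/3) + (1/6 - k/2) * (- 1/3)) = 4/3 - \<kappa>\<^sup>2"
    "4 * (1/6 + k/2) * (1/6 - k/2) * (- 1/3) = 8/27 - \<kappa>\<^sup>2 / 3"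
  proof -
    have "\<kappa>\<^sup>2 = 1 - k\<^sup>2" using k(3) by simp
    then show "- 4 * ((1/6 + k/2) * (1/6 - k/2) + (1/6 + k/2) * (- 1/3) + (1/6 - k/2) * (- 1/3)) = 4/3 - \<kappa>\<^sup>2"
      "4 * (1/6 + k/2) * (1/6 - k/2) * (- 1/3) = 8/27 - \<kappa>\<^sup>2 / 3"
      by (simp_all add: power2_eq_square field_simps)
  qed
  obtain w1 w2 where lat: "complex_lattice w1 w2"
    and g2: "g2_lattice w1 w2 = of_real (4/3 - \<kappa>\<^sup>2)" and g3: "g3_lattice w1 w2 = of_real (8/27 - \<kappa>\<^sup>2 / 3)"
    and wp: "weierstrass_p (of_real (4/3 - \<kappa>\<^sup>2)) (of_real (8/27 - \<kappa>\<^sup>2 / 3)) = wp_lattice w1 w2"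
    by (rule weierstrass_p_lattice[OF ex[unfolded g]])
  define K where "K = complex_of_real (\<kappa>\<^sup>2)"
  have "K \<noteq> 0" "g2_lattice w1 w2 = 4/3 - K" "g3_lattice w1 w2 = 8/27 - K / 3"
    using \<open>\<kappa>\<^sup>2 > 0\<close> g2 g3 by (simp_all add: K_def)
  then obtain r Q where r: "r > 0" and holQ: "Q holomorphic_on ball 0 r" and Q0: "Q 0 = 0" "deriv Q 0 = 0"
    and Qwp: "\<forall>z\<in>ball 0 r - {0}. Q z = (K / 2) / (wp_lattice w1 w2 z + 1/3)"
    and QQ: "\<forall>z\<in>ball 0 r. deriv (deriv Q) z = K - 4 * Q z + 3 * (Q z)\<^sup>2"
    by (rule complex_lattice.wp_reciprocal_ode[OF lat])
  obtain \<epsilon>1 where \<epsilon>1: "\<epsilon>1 > 0"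
    "\<forall>u. \<bar>u\<bar> < \<epsilon>1 \<longrightarrow> ((\<lambda>u. 1 - cos (psi u)) has_real_derivative 2 * \<kappa> * sin (psi u / 2) * cos (phi u)) (at u)"
    "\<forall>u. \<bar>u\<bar> < \<epsilon>1 \<longrightarrow> ((\<lambda>u. 2 * \<kappa> * sin (psi u / 2) * cos (phi u)) has_real_derivative
        \<kappa>\<^sup>2 - 4 * (1 - cos (psi u)) + 3 * (1 - cos (psi u))\<^sup>2) (at u)"
    by (rule psi_derivatives[OF assms(1,2,3,5,6,7,8)])
  have "continuous_on (ball 0 r) Q" using holQ by (rule holomorphic_on_imp_continuous_on)
  then have "isCont Q 0" using r by (simp add: continuous_on_eq_continuous_at)
  then obtain r1 where r1: "r1 > 0" "\<And>z. norm z < r1 \<Longrightarrow> norm (Q z) < 1"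
    unfolding continuous_at_eps_delta using Q0(1) by (metis dist_0_norm dist_commute zero_less_one)
  define \<delta>' where "\<delta>' = min \<epsilon>1 (min r r1)"
  have \<delta>': "\<delta>' > 0" using \<epsilon>1(1) r r1(1) by (simp add: \<delta>'_def)
  define y where "y = (\<lambda>u. complex_of_real (1 - cos (psi u)))"
  define f where "f = (\<lambda>u. y u - Q (of_real u))"
  define f' where "f' = (\<lambda>u. complex_of_real (2 * \<kappa> * sin (psi u / 2) * cos (phi u)) - deriv Q (of_real u))"
  define f'' where "f'' = (\<lambda>u. complex_of_real (\<kappa>\<^sup>2 - 4 * (1 - cos (psi u)) + 3 * (1 - cos (psi u))\<^sup>2) - deriv (deriv Q) (of_real u))"
  obtain \<epsilon> where \<epsilon>: "\<epsilon> > 0" "\<And>u. \<bar>u\<bar> < \<epsilon> \<Longrightarrow> f u = 0"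
  \<comment> \<open>The right-hand sides for \<open>y\<close> and \<open>Q\<close> differ by
    \<open>(3 (y + Q) - 4) (y - Q)\<close>. As \<open>y\<close> has norm at most \<open>2\<close>
    and \<open>Q\<close> norm below \<open>1\<close>, the first factor is at most
    \<open>3 * 3 + 4 = 13\<close>.\<close>
  proof (rule second_order_gronwall[of \<delta>' f f' f'' 13])
    fix u assume u: "\<bar>u\<bar> < \<delta>'"
    then have ub: "complex_of_real u \<in> ball 0 r" and u1: "\<bar>u\<bar> < \<epsilon>1" and ur: "norm (complex_of_real u) < r1"
      by (auto simp: \<delta>'_def)
    have "(Q has_field_derivative deriv Q (of_real u)) (at (of_real u))"
      using holQ ub by (simp add: holomorphic_derivI)
    then have dQ: "((\<lambda>u. Q (of_real u)) has_vector_derivative deriv Q (of_real u)) (at u)"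
      by (rule has_vector_derivative_real_field)
    have "(deriv Q has_field_derivative deriv (deriv Q) (of_real u)) (at (of_real u))"
      using holomorphic_deriv[OF holQ open_ball] ub by (simp add: holomorphic_derivI)
    then have ddQ: "((\<lambda>u. deriv Q (of_real u)) has_vector_derivative deriv (deriv Q) (of_real u)) (at u)"
      by (rule has_vector_derivative_real_field)
    show "(f has_vector_derivative f' u) (at u)" unfolding f_def f'_def y_def
      by (intro has_vector_derivative_diff dQ has_vector_derivative_of_real
          \<epsilon>1(2)[rule_format, OF u1])
    show "(f' has_vector_derivative f'' u) (at u)" unfolding f'_def f''_def
      by (intro has_vector_derivative_diff ddQ has_vector_derivative_of_real
          \<epsilon>1(3)[rule_format, OF u1])
    have "f'' u = (3 * (y u + Q (of_real u)) - 4) * f u"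
      by (simp add: f''_def bspec[OF QQ ub] K_def f_def y_def power2_eq_square algebra_simps)
    moreover have "norm (3 * (y u + Q (of_real u)) - 4) \<le> 13"
    proof -
      have "norm (y u) \<le> 2" unfolding y_def norm_of_real using cos_ge_minus_one[of "psi u"] cos_le_one[of "psi u"] by simp
      then have "norm (y u + Q (of_real u)) \<le> 3"
        using r1(2)[OF ur] norm_triangle_ineq[of "y u" "Q (of_real u)"] by linarith
      moreover have "norm (3 * w - 4) \<le> 13" if "norm w \<le> 3" for w :: complex
        using norm_triangle_ineq4[of "3 * w" 4] that by (simp add: norm_mult)
      ultimately show ?thesis by blast
    qed
    ultimately show "norm (f'' u) \<le> 13 * norm (f u)" by (simp add: norm_mult mult_right_mono)
  qed (use \<delta>' assms(6) Q0 in \<open>simp_all add: f_def f'_def y_def\<close>)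
  show ?thesis
  proof (intro exI conjI allI impI)
    show "min \<epsilon> r > 0" using \<epsilon>(1) r by simp
    \<comment> \<open>The origin is excluded: since \<open>1 / 0 = 0\<close>,
      \<open>wp_lattice\<close> takes the value \<open>0\<close> there instead of having a pole, and
      the quotient differs from its continuous extension \<open>Q\<close>.\<close>
    fix u :: real assume u: "0 < \<bar>u\<bar> \<and> \<bar>u\<bar> < min \<epsilon> r"
    then have "complex_of_real u \<in> ball 0 r - {0}" by auto
    from bspec[OF Qwp this] have "Q (of_real u) = complex_of_real (\<kappa>\<^sup>2 / 2) / (wp_lattice w1 w2 (of_real u) + 1/3)"
      by (simp add: K_def)
    moreover have "y u = Q (of_real u)" using \<epsilon>(2)[of u] u by (simp add: f_def)
    then have "complex_of_real (cos (psi u)) = 1 - Q (of_real u)" by (simp add: y_def flip: \<open>y u = Q (of_real u)\<close>)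
    ultimately show "complex_of_real (cos (psi u)) =
             1 - complex_of_real (\<kappa>\<^sup>2 / 2) /
                   (weierstrass_p (of_real (4/3 - \<kappa>\<^sup>2)) (of_real (8/27 - \<kappa>\<^sup>2 / 3))
                      (complex_of_real u) + 1/3)"
      by (simp only: wp)
  qed
qed

end
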